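(* For every prime number $\ell$ and every integer $n>1$, there exist finite $\ell$-groups of rank $n$ which do not belong to $\mathcal G(\ell)$.
   Context: The rank of a finite group $G$ is the minimal number of generators of $G$. For a prime $\ell$, $\mathcal G(\ell)$ is the minimal family of finite $\ell$-groups (closed under isomorphism) which contains all cyclic groups of $\ell$-power order and is closed under direct products, regular wreath products, and rank-preserving homomorphic images (quotients $G/N$ with $\operatorname{rank}(G/N)=\operatorname{rank}(G)$; equivalently, with $N$ a normal subgroup contained in the Frattini subgroup $\Phi(G)$). Regular wreath product: for finite groups $G,H$, $H\wr G$ is the semidirect product $H^{|G|}\rtimes G$, where $H^{|G|}$ is the direct product of $|G|$ copies of $H$ and $G$ acts by permuting the copies of $H$ like the regular (Cayley) representation of $G$. *)

theory Defs
  imports "HOL-Algebra.Algebra"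
begin

definition finite_p_group :: "nat \<Rightarrow> ('a, 'b) monoid_scheme \<Rightarrow> bool" where
  "finite_p_group p G \<longleftrightarrow> group G \<and> finite (carrier G) \<and> (\<exists>k. order G = p ^ k)"

definition group_rank :: "('a, 'b) monoid_scheme \<Rightarrow> nat" where
  "group_rank G = (LEAST n. \<exists>S. S \<subseteq> carrier G \<and> finite S \<and> card S = n \<and> generate G S = carrier G)"

definition semidirect_product ::
    "('a, 'c) monoid_scheme \<Rightarrow> ('b, 'd) monoid_scheme \<Rightarrow> ('b \<Rightarrow> 'a \<Rightarrow> 'a) \<Rightarrow> ('a \<times> 'b) monoid" where
  "semidirect_product N G \<phi> =
    \<lparr>carrier = carrier N \<times> carrier G,
     monoid.mult = (\<lambda>(m, g) (n, h). (m \<otimes>\<^bsub>N\<^esub> \<phi> g n, g \<otimes>\<^bsub>G\<^esub> h)),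
     one = (\<one>\<^bsub>N\<^esub>, \<one>\<^bsub>G\<^esub>)\<rparr>"

(* regular_wreath H G is H wr G. The copies of H are indexed by the elements of G,
   and g moves the copy at index x to index g x, whence the inverse below. *)
definition regular_wreath ::
    "('a, 'c) monoid_scheme \<Rightarrow> ('b, 'd) monoid_scheme \<Rightarrow> (('b \<Rightarrow> 'a) \<times> 'b) monoid" where
  "regular_wreath H G =
    semidirect_product (product_group (carrier G) (\<lambda>_. H)) G
      (\<lambda>g f. \<lambda>x\<in>carrier G. f (inv\<^bsub>G\<^esub> g \<otimes>\<^bsub>G\<^esub> x))"

(* The constructions change the type of the elements, so the family is represented by groups
   with elements in nat, which realise every finite group up to isomorphism
   (see finite_group_nat_copy), and every rule is closed under isomorphic copies. *)
inductive wreath_family :: "nat \<Rightarrow> nat monoid \<Rightarrow> bool" for p :: nat where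
  cyclic: "\<lbrakk>group K; finite (carrier K); cyclic_group K; order K = p ^ k\<rbrakk> \<Longrightarrow> wreath_family p K"
| iso: "\<lbrakk>wreath_family p G; group K; K \<cong> G\<rbrakk> \<Longrightarrow> wreath_family p K"
| direct_product: "\<lbrakk>wreath_family p G; wreath_family p H; group K; K \<cong> G \<times>\<times> H\<rbrakk>
    \<Longrightarrow> wreath_family p K"
| wreath_product: "\<lbrakk>wreath_family p H; wreath_family p G; group K; K \<cong> regular_wreath H G\<rbrakk>
    \<Longrightarrow> wreath_family p K"
| quotient: "\<lbrakk>wreath_family p G; N \<lhd> G; group_rank (G Mod N) = group_rank G; group K; K \<cong> G Mod N\<rbrakk>
    \<Longrightarrow> wreath_family p K"

lemma finite_group_nat_copy:
  assumes "group G" "finite (carrier G)"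
  shows "\<exists>K :: nat monoid. group K \<and> K \<cong> G"
proof -
  interpret group G by fact
  obtain f :: "_ \<Rightarrow> nat" where f: "inj_on f (carrier G)"
    using finite_imp_inj_to_nat_seg[OF assms(2)] by blast
  define u where "u = inv_into (carrier G) f"
  have u: "u (f x) = x" if "x \<in> carrier G" for x
    using that f by (simp add: u_def)
  define K where "K = \<lparr>carrier = f ` carrier G, monoid.mult = (\<lambda>a b. f (u a \<otimes>\<^bsub>G\<^esub> u b)), one = f \<one>\<^bsub>G\<^esub>\<rparr>"
  have "f \<in> iso G K"
    using f by (auto simp: iso_def hom_def K_def bij_betw_def u)
  then have iso: "G \<cong> K" by (rule is_isoI)
  have "monoid K"
    by (rule monoidI) (auto simp: K_def u m_assoc)
  then have "group K" using iso_imp_group[OF iso] by blast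
  then show ?thesis using iso_sym[OF iso] by blast
qed

lemma semidirect_product_group:
  assumes "group N" "group G"
    and hom: "\<And>g. g \<in> carrier G \<Longrightarrow> \<phi> g \<in> hom N N"
    and one: "\<And>n. n \<in> carrier N \<Longrightarrow> \<phi> \<one>\<^bsub>G\<^esub> n = n"
    and mult: "\<And>g h n. \<lbrakk>g \<in> carrier G; h \<in> carrier G; n \<in> carrier N\<rbrakk>
                \<Longrightarrow> \<phi> (g \<otimes>\<^bsub>G\<^esub> h) n = \<phi> g (\<phi> h n)"
  shows "group (semidirect_product N G \<phi>)"
proof -
  interpret N: group N by fact
  interpret G: group G by fact
  have cl: "\<phi> g n \<in> carrier N" if "g \<in> carrier G" "n \<in> carrier N" for g n
    using hom_in_carrier[OF hom] that by blast
  have hm: "\<phi> g (m \<otimes>\<^bsub>N\<^esub> n) = \<phi> g m \<otimes>\<^bsub>N\<^esub> \<phi> g n"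
    if "g \<in> carrier G" "m \<in> carrier N" "n \<in> carrier N" for g m n
    using hom_mult[OF hom] that by blast
  have h1: "\<phi> g \<one>\<^bsub>N\<^esub> = \<one>\<^bsub>N\<^esub>" if "g \<in> carrier G" for g
    using hom_one[OF hom[OF that]] assms(1) by simp
  show ?thesis
  proof (rule groupI)
    fix x assume "x \<in> carrier (semidirect_product N G \<phi>)"
    then obtain n g where x: "x = (n, g)" "n \<in> carrier N" "g \<in> carrier G"
      by (auto simp: semidirect_product_def)
    have "(\<phi> (inv\<^bsub>G\<^esub> g) (inv\<^bsub>N\<^esub> n), inv\<^bsub>G\<^esub> g) \<in> carrier (semidirect_product N G \<phi>)"
      using x cl by (simp add: semidirect_product_def)
    moreover have "\<phi> (inv\<^bsub>G\<^esub> g) (inv\<^bsub>N\<^esub> n) \<otimes>\<^bsub>N\<^esub> \<phi> (inv\<^bsub>G\<^esub> g) n = \<one>\<^bsub>N\<^esub>"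
      using x by (simp add: hm[symmetric] h1)
    ultimately show "\<exists>y\<in>carrier (semidirect_product N G \<phi>).
        y \<otimes>\<^bsub>semidirect_product N G \<phi>\<^esub> x = \<one>\<^bsub>semidirect_product N G \<phi>\<^esub>"
      using x by (intro bexI[of _ "(\<phi> (inv\<^bsub>G\<^esub> g) (inv\<^bsub>N\<^esub> n), inv\<^bsub>G\<^esub> g)"])
        (auto simp: semidirect_product_def)
  qed (auto simp: semidirect_product_def cl one hm mult N.m_assoc G.m_assoc)
qed

lemma regular_wreath_group:
  assumes "group H" "group G"
  shows "group (regular_wreath H G)"
  unfolding regular_wreath_def
proof (rule semidirect_product_group)
  interpret G: group G by fact
  interpret H: group H by fact
  let ?N = "product_group (carrier G) (\<lambda>_. H)"
  let ?a = "\<lambda>g f. \<lambda>x\<in>carrier G. f (inv\<^bsub>G\<^esub> g \<otimes>\<^bsub>G\<^esub> x)"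
  show "group ?N" "group G" using assms by simp_all
  show "?a g \<in> hom ?N ?N" if "g \<in> carrier G" for g
    using that by (auto simp: hom_def Pi_iff PiE_iff fun_eq_iff)
  show "?a \<one>\<^bsub>G\<^esub> n = n" if "n \<in> carrier ?N" for n
    using that by (auto simp: fun_eq_iff PiE_iff extensional_def)
  show "?a (g \<otimes>\<^bsub>G\<^esub> h) n = ?a g (?a h n)"
    if "g \<in> carrier G" "h \<in> carrier G" "n \<in> carrier ?N" for g h n
    using that by (auto simp: fun_eq_iff G.inv_mult_group G.m_assoc)
qed

lemma order_regular_wreath:
  assumes "finite (carrier G)"
  shows "order (regular_wreath H G) = order H ^ order G * order G"
  using assms
  by (simp add: order_def regular_wreath_def semidirect_product_def card_cartesian_product card_PiE)

lemma wreath_family_finite_p_group: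
  assumes "wreath_family p K" "Factorial_Ring.prime p"
  shows "finite_p_group p K"
  using assms
proof (induction rule: wreath_family.induct)
  case (cyclic K k)
  then show ?case by (auto simp: finite_p_group_def)
next
  case (iso G K)
  then show ?case
    using iso_finite[of K G] iso_same_card[of K G] by (auto simp: finite_p_group_def order_def)
next
  case (direct_product G H K)
  then obtain i j where "order G = p ^ i" "order H = p ^ j"
    by (auto simp: finite_p_group_def)
  then have "order K = p ^ (i + j)"
    using iso_same_card[OF direct_product.hyps(4)]
    by (simp add: order_def DirProd_def card_cartesian_product power_add)
  moreover have "finite (carrier K)"
    using direct_product iso_finite[of K "G \<times>\<times> H"] by (auto simp: finite_p_group_def)
  ultimately show ?case using direct_product.hyps by (auto simp: finite_p_group_def)
next
  case (wreath_product H G K)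
  then obtain i j where "order G = p ^ i" "order H = p ^ j" "finite (carrier G)"
    by (auto simp: finite_p_group_def)
  then have "order K = p ^ (j * order G + i)"
    using iso_same_card[OF wreath_product.hyps(4)] order_regular_wreath[of G H]
    by (simp add: order_def power_add power_mult)
  moreover from this have "finite (carrier K)"
    using wreath_product.prems by (metis card.infinite not_prime_0 order_def power_not_zero)
  ultimately show ?case using wreath_product.hyps by (auto simp: finite_p_group_def)
next
  case (quotient G N K)
  then obtain i where i: "order G = p ^ i" "group G" "finite (carrier G)"
    by (auto simp: finite_p_group_def)
  interpret N: normal N G by fact
  have "order (G Mod N) * card N = order G"
    using N.lagrange[OF N.subgroup_axioms] by (simp add: FactGroup_def order_def)
  then have "order (G Mod N) dvd p ^ i" using i by (metis dvd_triv_left)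
  then obtain k where "order (G Mod N) = p ^ k"
    using quotient.prems by (auto simp: divides_primepow_nat)
  then have k: "order K = p ^ k"
    using iso_same_card[OF quotient.hyps(5)] by (simp add: order_def)
  then have "finite (carrier K)"
    using quotient.prems by (metis card.infinite not_prime_0 order_def power_not_zero)
  with k show ?case using quotient.hyps by (auto simp: finite_p_group_def)
qed

end

theory Submission
  imports Defs "HOL-Number_Theory.Cong"
begin

text \<open>Every nontrivial group in the family has an element \<open>a\<close> outside its Frattini subgroup whose
normal closure is abelian, that is, \<open>a\<close> commutes with all of its conjugates. Indeed, a generator
of a cyclic group has this property; in a direct product one takes such an element of one factor,
and in \<open>H \<wr> G\<close> with \<open>H\<close> nontrivial the element of the base group whose single nontrivial entry is
such an element \<open>a\<close> of \<open>H\<close>: two of its conjugates either live in different copies of \<open>H\<close> or are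
conjugates of \<open>a\<close> in the same copy. For trivial \<open>H\<close> the wreath product is just \<open>G\<close>. A
rank-preserving quotient map has its kernel inside the Frattini subgroup, so the image of \<open>a\<close> still
has the property. This is lemma \<open>wreath_family_abelian_closure_outside_frattini\<close>.

A group of rank \<open>n\<close> without such an element is obtained from any finite \<open>l\<close>-group \<open>P\<close> that contains
an element \<open>a\<close> not commuting with one of its conjugates \<open>b a b\<inverse>\<close>. Let \<open>R\<close> be the free group of rank
\<open>n\<close> in the variety generated by \<open>P\<close>; it is a finite \<open>l\<close>-group, concretely the subgroup generated by
the \<open>n\<close> coordinate projections inside the power of \<open>P\<close> indexed by \<open>n\<close>-tuples over \<open>P\<close>. Any
\<open>n\<close>-tuple that generates \<open>R\<close> is the image of the basis under a surjective, hence bijective,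
endomorphism. So \<open>R\<close> has rank exactly \<open>n\<close>, and every element of a generating \<open>n\<close>-tuple behaves like
a basis element: for \<open>n > 1\<close> one can send it to \<open>a\<close> and another element of the tuple to \<open>b\<close>,
so it cannot commute with all of its conjugates. By the exchange property of generating sets,
every element outside the Frattini subgroup belongs to a generating \<open>n\<close>-tuple. Hence \<open>R\<close> is
not in the family.

The Frattini subgroup enters only through the homomorphisms to the integers modulo \<open>l\<close>: an
element of a finite \<open>l\<close>-group lies outside the Frattini subgroup if and only if one of these
does not vanish on it. The fact behind the exchange property is that every proper subgroup of a
finite \<open>l\<close>-group is killed by a nonzero homomorphism of this kind
(\<open>p_group_mod_character_separates\<close>).\<close>

section \<open>Homomorphisms to the integers modulo p\<close>

text \<open>A homomorphism from \<open>G\<close> to the integers modulo \<open>p\<close>, given by arbitrary integer representatives of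
its values. Linear combinations of such homomorphisms are then ordinary integer combinations, and
statements about values are congruences.\<close>
definition mod_character :: "nat \<Rightarrow> ('a, 'b) monoid_scheme \<Rightarrow> ('a \<Rightarrow> int) \<Rightarrow> bool" where
  "mod_character p G \<chi> \<longleftrightarrow>
    (\<forall>x\<in>carrier G. \<forall>y\<in>carrier G. [\<chi> (x \<otimes>\<^bsub>G\<^esub> y) = \<chi> x + \<chi> y] (mod int p))"

context group
begin

lemma mod_character_one:
  assumes "mod_character p G \<chi>"
  shows "[\<chi> \<one> = 0] (mod int p)"
proof -
  have "[\<chi> (\<one> \<otimes> \<one>) = \<chi> \<one> + \<chi> \<one>] (mod int p)"
    using assms unfolding mod_character_def by blast
  then have "[0 + \<chi> \<one> = \<chi> \<one> + \<chi> \<one>] (mod int p)" by simp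
  then show ?thesis using cong_add_rcancel cong_sym by blast
qed

lemma subgroup_mod_character_kernel:
  assumes "mod_character p G \<chi>"
  shows "subgroup {x \<in> carrier G. [\<chi> x = 0] (mod int p)} G"
proof (rule subgroupI)
  fix a assume a: "a \<in> {x \<in> carrier G. [\<chi> x = 0] (mod int p)}"
  have "[\<chi> (a \<otimes> inv a) = \<chi> a + \<chi> (inv a)] (mod int p)"
  proof -
    have "a \<in> carrier G" "inv a \<in> carrier G" using a by simp_all
    then show ?thesis using assms unfolding mod_character_def by metis
  qed
  then have "[\<chi> a + \<chi> (inv a) = 0] (mod int p)"
    using a mod_character_one[OF assms] by (metis (no_types, lifting) cong_sym cong_trans mem_Collect_eq r_inv)
  moreover have "[\<chi> a + \<chi> (inv a) = 0 + \<chi> (inv a)] (mod int p)"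
    using a by (intro cong_add) auto
  ultimately show "inv a \<in> {x \<in> carrier G. [\<chi> x = 0] (mod int p)}"
    using a by (simp add: cong_def)
next
  fix a b assume a: "a \<in> {x \<in> carrier G. [\<chi> x = 0] (mod int p)}"
    and b: "b \<in> {x \<in> carrier G. [\<chi> x = 0] (mod int p)}"
  have "[\<chi> (a \<otimes> b) = \<chi> a + \<chi> b] (mod int p)"
    using a b assms by (simp add: mod_character_def)
  moreover have "[\<chi> a + \<chi> b = 0 + 0] (mod int p)"
    using a b by (intro cong_add) auto
  ultimately show "a \<otimes> b \<in> {x \<in> carrier G. [\<chi> x = 0] (mod int p)}"
    using a b by (auto intro: cong_trans)
qed (use mod_character_one[OF assms] in auto)

lemma mod_character_vanishes_on_generate:
  assumes "mod_character p G \<chi>" "S \<subseteq> carrier G" "\<And>s. s \<in> S \<Longrightarrow> [\<chi> s = 0] (mod int p)"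
    and "x \<in> generate G S"
  shows "[\<chi> x = 0] (mod int p)"
  using generate_subgroup_incl[OF _ subgroup_mod_character_kernel[OF assms(1)], of S] assms by blast

lemma mod_character_sum:
  assumes "\<And>i. i \<in> I \<Longrightarrow> mod_character p G (\<chi> i)"
  shows "mod_character p G (\<lambda>x. \<Sum>i\<in>I. \<chi> i x)"
  unfolding mod_character_def
proof (intro ballI)
  fix x y assume "x \<in> carrier G" "y \<in> carrier G"
  then have "[(\<Sum>i\<in>I. \<chi> i (x \<otimes> y)) = (\<Sum>i\<in>I. \<chi> i x + \<chi> i y)] (mod int p)"
    using assms by (intro cong_sum) (auto simp: mod_character_def)
  then show "[(\<Sum>i\<in>I. \<chi> i (x \<otimes> y)) = (\<Sum>i\<in>I. \<chi> i x) + (\<Sum>i\<in>I. \<chi> i y)] (mod int p)"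
    by (simp add: sum.distrib)
qed

lemma mod_character_scaled:
  assumes "mod_character p G \<chi>"
  shows "mod_character p G (\<lambda>x. c * \<chi> x)"
  unfolding mod_character_def
proof (intro ballI)
  fix x y assume "x \<in> carrier G" "y \<in> carrier G"
  then have "[c * \<chi> (x \<otimes> y) = c * (\<chi> x + \<chi> y)] (mod int p)"
    using assms by (intro cong_scalar_left) (simp add: mod_character_def)
  then show "[c * \<chi> (x \<otimes> y) = c * \<chi> x + c * \<chi> y] (mod int p)"
    by (simp add: distrib_left)
qed

lemma mod_character_diff:
  assumes "mod_character p G \<chi>" "mod_character p G \<psi>"
  shows "mod_character p G (\<lambda>x. \<chi> x - \<psi> x)"
  unfolding mod_character_def
proof (intro ballI)
  fix x y assume "x \<in> carrier G" "y \<in> carrier G"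
  then have "[\<chi> (x \<otimes> y) - \<psi> (x \<otimes> y) = (\<chi> x + \<chi> y) - (\<psi> x + \<psi> y)] (mod int p)"
    using assms by (intro cong_diff) (simp_all add: mod_character_def)
  then show "[\<chi> (x \<otimes> y) - \<psi> (x \<otimes> y) = (\<chi> x - \<psi> x) + (\<chi> y - \<psi> y)] (mod int p)"
    by (simp add: algebra_simps)
qed

lemma subgroup_if_finite_mult_closed:
  assumes "finite (carrier G)" "U \<subseteq> carrier G" "\<one> \<in> U"
    and "\<And>x y. x \<in> U \<Longrightarrow> y \<in> U \<Longrightarrow> x \<otimes> y \<in> U"
  shows "subgroup U G"
proof (rule subgroupI)
  fix a assume a: "a \<in> U"
  then have aG: "a \<in> carrier G" using assms(2) by blast
  have "a [^] (n::nat) \<in> U" for n by (induction n) (use assms a in auto)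
  moreover have "a [^] (order G - 1) \<otimes> a = \<one>"
    using pow_order_eq_1[OF aG] order_gt_0_iff_finite assms(1)
    by (metis Suc_pred' nat_pow_Suc)
  then have "inv a = a [^] (order G - 1)" using aG by (metis inv_equality nat_pow_closed)
  ultimately show "inv a \<in> U" by simp
qed (use assms in auto)

end

section \<open>Proper subgroups of p-groups are killed by a nonzero homomorphism\<close>

text \<open>The orbits that are not singletons have size divisible by \<open>p\<close>, so the number of fixed points is
divisible by \<open>p\<close> and cannot be one.\<close>
lemma (in group_action) p_group_second_fixed_point:
  assumes "Factorial_Ring.prime p" "order G = p ^ k" "finite E" "p dvd card E"
    and x: "x \<in> E" "\<And>g. g \<in> carrier G \<Longrightarrow> \<phi> g x = x"
  shows "\<exists>y\<in>E. y \<noteq> x \<and> (\<forall>g\<in>carrier G. \<phi> g y = y)"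
proof (rule ccontr)
  assume neg: "\<not> ?thesis"
  interpret group G using group_hom group_hom.axioms(1) by auto
  have part: "disjoint (orbits G E \<phi>)" "\<Union> (orbits G E \<phi>) = E"
    using orbit_partition
    by (auto simp: partition_def disjoint_def)
  have orbx: "orbit G \<phi> x = {x}"
    using x by (auto simp: orbit_def intro: exI[of _ \<one>])
  have U: "\<Union> (orbits G E \<phi> - {{x}}) = E - {x}"
  proof -
    have xo: "{x} \<in> orbits G E \<phi>" unfolding orbits_def using orbx[symmetric] x(1) by blast
    have "c \<inter> {x} = {}" if "c \<in> orbits G E \<phi> - {{x}}" for c
      using disjointD[OF part(1) _ xo, of c] that by simp
    then have "\<Union> (orbits G E \<phi> - {{x}}) = \<Union> (orbits G E \<phi>) - {x}"
      by blast
    then show ?thesis using part(2) by simp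
  qed
  have "p dvd card (\<Union> (orbits G E \<phi> - {{x}}))"
  proof (rule dvd_partition)
    show "finite (\<Union> (orbits G E \<phi> - {{x}}))" unfolding U using assms(3) by simp
    show "\<forall>c1\<in>orbits G E \<phi> - {{x}}. \<forall>c2\<in>orbits G E \<phi> - {{x}}. c1 \<noteq> c2 \<longrightarrow> c1 \<inter> c2 = {}"
      using part by (auto simp: disjoint_def)
    show "\<forall>c\<in>orbits G E \<phi> - {{x}}. p dvd card c"
    proof
      fix c assume c: "c \<in> orbits G E \<phi> - {{x}}"
      then obtain y where y: "y \<in> E" "c = orbit G \<phi> y" by (auto simp: orbits_def)
      have "card c dvd p ^ k" using orbit_stabilizer_theorem[OF y(1)] y assms(2) by (metis dvd_triv_left)
      then obtain j where j: "card c = p ^ j" using assms(1) by (auto simp: divides_primepow_nat)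
      have "card c \<noteq> 1"
      proof
        assume "card c = 1"
        then have "c = {y}" using orbit_refl[OF y(1)] y by (metis card_1_singletonE singletonD)
        then have "\<forall>g\<in>carrier G. \<phi> g y = y" using y by (auto simp: orbit_def)
        then have "y = x" using neg y by blast
        then show False using c \<open>c = {y}\<close> by blast
      qed
      then show "p dvd card c" using j by (cases j) auto
    qed
  qed
  then have "p dvd card E - 1" using U assms(3) x by simp
  moreover have "card E \<noteq> 0" using x assms(3) by auto
  ultimately have "p dvd 1" using assms(4) by (metis Suc_pred' bot_nat_0.not_eq_extremum dvd_add_right_iff plus_1_eq_Suc add.commute)
  then show False using assms(1) by (metis not_prime_unit)
qed

text \<open>The inverse turns multiplication from the right into an action from the left.\<close>
lemma (in group) group_action_right_cosets:
  assumes "subgroup M G"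
  shows "group_action (G\<lparr>carrier := M\<rparr>) (rcosets M) (\<lambda>m. \<lambda>R\<in>rcosets M. R #> inv m)"
proof -
  interpret M: subgroup M G by fact
  have MG: "group (G\<lparr>carrier := M\<rparr>)" using subgroup_imp_group[OF assms] .
  have sub: "R \<subseteq> carrier G" if "R \<in> rcosets M" for R
    using that assms by (metis M.rcosets_carrier is_group)
  have cl: "R #> g \<in> rcosets M" if "R \<in> rcosets M" "g \<in> carrier G" for R g
    using that by (auto simp: RCOSETS_def coset_mult_assoc M.subset intro!: exI bexI[of _ "_ \<otimes> g"])
  have inverse: "(R #> g) #> h = R" if "R \<in> rcosets M" "g \<in> carrier G" "h \<in> carrier G" "g \<otimes> h = \<one>" for R g h
    using that sub by (simp add: coset_mult_assoc)
  have bij: "bij_betw (\<lambda>R\<in>rcosets M. R #> inv m) (rcosets M) (rcosets M)" if "m \<in> M" for m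
  proof (rule bij_betwI[where g = "\<lambda>R. R #> m"])
  qed (use that inverse cl in auto)
  show ?thesis
    unfolding group_action_def group_hom_def group_hom_axioms_def
  proof (intro conjI MG group_BijGroup homI)
    fix m assume "m \<in> carrier (G\<lparr>carrier := M\<rparr>)"
    then show "(\<lambda>R\<in>rcosets M. R #> inv m) \<in> carrier (BijGroup (rcosets M))"
      using bij by (simp add: BijGroup_def Bij_def)
  next
    fix m m' assume "m \<in> carrier (G\<lparr>carrier := M\<rparr>)" "m' \<in> carrier (G\<lparr>carrier := M\<rparr>)"
    then have m: "m \<in> M" "m' \<in> M" by auto
    have "(\<lambda>R\<in>rcosets M. R #> inv (m \<otimes> m')) =
        compose (rcosets M) (\<lambda>R\<in>rcosets M. R #> inv m) (\<lambda>R\<in>rcosets M. R #> inv m')"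
      using m sub cl by (auto simp: compose_def fun_eq_iff coset_mult_assoc inv_mult_group)
    then show "(\<lambda>R\<in>rcosets M. R #> inv (m \<otimes>\<^bsub>G\<lparr>carrier := M\<rparr>\<^esub> m')) =
        (\<lambda>R\<in>rcosets M. R #> inv m) \<otimes>\<^bsub>BijGroup (rcosets M)\<^esub> (\<lambda>R\<in>rcosets M. R #> inv m')"
      using bij m by (simp add: BijGroup_def Bij_def)
  qed
qed

text \<open>\<open>M\<close> acts on its right cosets and fixes the coset \<open>M\<close> itself. The index of \<open>M\<close> is divisible by
\<open>p\<close>, so \<open>M\<close> fixes a second coset \<open>M g\<close>, and \<open>M g m = M g\<close> for all \<open>m \<in> M\<close> means that \<open>g\<close>
normalizes \<open>M\<close>. The inclusion \<open>g M \<subseteq> M g\<close> is the form in which products of \<open>g\<close> and elements of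
\<open>M\<close> are sorted later.\<close>
lemma (in group) p_group_normalizer_grows:
  assumes "Factorial_Ring.prime p" "finite_p_group p G" "subgroup M G" "M \<noteq> carrier G"
  shows "\<exists>g\<in>carrier G - M. \<forall>m\<in>M. \<exists>m'\<in>M. g \<otimes> m = m' \<otimes> g"
proof -
  interpret M: subgroup M G by fact
  interpret act: group_action "G\<lparr>carrier := M\<rparr>" "rcosets M" "\<lambda>m. \<lambda>R\<in>rcosets M. R #> inv m"
    using group_action_right_cosets[OF assms(3)] .
  obtain k where k: "order G = p ^ k" and fin: "finite (carrier G)"
    using assms(2) by (auto simp: finite_p_group_def)
  have lag: "card (rcosets M) * card M = p ^ k" using lagrange[OF assms(3)] k by simp
  obtain i where i: "card M = p ^ i"
    using lag assms(1) by (metis dvd_triv_right divides_primepow_nat)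
  obtain j where j: "card (rcosets M) = p ^ j"
    using lag assms(1) by (metis dvd_triv_left divides_primepow_nat)
  have "card (rcosets M) \<noteq> 1"
  proof
    assume "card (rcosets M) = 1"
    then have "card M = card (carrier G)" using lag k by (simp add: order_def)
    then show False using fin M.subset assms(4) by (metis card_subset_eq)
  qed
  then have pd: "p dvd card (rcosets M)" using j by (cases j) auto
  have M1: "M \<in> rcosets M" using assms(3) by (metis coset_join2 M.one_closed one_closed rcosetsI M.subset)
  have "\<exists>y\<in>rcosets M. y \<noteq> M \<and>
      (\<forall>g\<in>carrier (G\<lparr>carrier := M\<rparr>). (\<lambda>R\<in>rcosets M. R #> inv g) y = y)"
  proof (rule act.p_group_second_fixed_point[OF assms(1) _ _ pd M1])
    show "order (G\<lparr>carrier := M\<rparr>) = p ^ i" using i by (simp add: order_def)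
    show "finite (rcosets M)" using j assms(1) by (metis card.infinite not_prime_0 power_not_zero)
    show "(\<lambda>R\<in>rcosets M. R #> inv g) M = M" if "g \<in> carrier (G\<lparr>carrier := M\<rparr>)" for g
      using that M1 assms(3) by (simp add: coset_join2)
  qed
  then obtain y where y: "y \<in> rcosets M" "y \<noteq> M" "\<And>m. m \<in> M \<Longrightarrow> y #> inv m = y"
    by auto
  obtain g where g: "g \<in> carrier G" "y = M #> g" using y(1) by (auto simp: RCOSETS_def)
  have "g \<notin> M" using g y(2) assms(3) coset_join2 by blast
  moreover have "\<exists>m'\<in>M. g \<otimes> m = m' \<otimes> g" if "m \<in> M" for m
  proof -
    have "g \<in> y" using g by (simp add: rcos_self assms(3))
    then have "g \<otimes> inv (inv m) \<in> y #> inv (inv m)" by (auto simp: r_coset_def)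
    also have "y #> inv (inv m) = y" using y(3)[of "inv m"] that by simp
    finally show ?thesis using that g by (auto simp: r_coset_def)
  qed
  ultimately show ?thesis using g by blast
qed

context group
begin

lemma maximal_proper_subgroup_exists:
  assumes "finite (carrier G)" "subgroup M G" "M \<noteq> carrier G"
  obtains M' where "subgroup M' G" "M \<subseteq> M'" "M' \<noteq> carrier G"
    "\<And>U. subgroup U G \<Longrightarrow> M' \<subset> U \<Longrightarrow> U = carrier G"
proof -
  let ?A = "{U. subgroup U G \<and> U \<noteq> carrier G}"
  have "finite ?A"
    using assms(1) by (intro finite_subset[of ?A "Pow (carrier G)"]) (auto dest: subgroup.subset)
  then obtain M' where "M' \<in> ?A" "M \<subseteq> M'" "\<forall>U\<in>?A. M' \<subseteq> U \<longrightarrow> M' = U"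
    using finite_has_maximal2[of ?A M] assms by blast
  then show ?thesis by (intro that[of M']) auto
qed

text \<open>If \<open>p\<close> did not divide \<open>d\<close>, then \<open>g\<close> would be a power of \<open>g\<^sup>d\<close>, because \<open>d\<close> would be invertible
modulo the order of the group. So the powers of \<open>g\<close> in one coset of \<open>M\<close> have exponents that agree
modulo \<open>p\<close>.\<close>
lemma p_group_power_congruence:
  assumes p: "Factorial_Ring.prime p" "order G = p ^ k"
    and M: "subgroup M G" and g: "g \<in> carrier G" "g \<notin> M"
    and d: "g [^] (d::nat) \<in> M"
  shows "p dvd d"
proof (rule ccontr)
  interpret M: subgroup M G by fact
  assume "\<not> p dvd d"
  then have "coprime d (p ^ k)"
    using p(1) prime_imp_coprime[of p d] by (simp add: coprime_commute)
  then obtain e where e: "[d * e = 1] (mod p ^ k)" using cong_solve_coprime_nat by (metis One_nat_def)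
  then have "g [^] (d * e) = g [^] (1::nat)"
  proof -
    have "int (p ^ k) dvd int 1 - int (d * e)"
      using e by (metis cong_iff_dvd_diff cong_int_iff cong_sym)
    moreover have "int (ord g) dvd int (p ^ k)"
      using ord_dvd_group_order[OF g(1)] p(2) by (metis int_dvd_int_iff)
    ultimately have "g [^] int (d * e) = g [^] int 1"
      using int_pow_eq[OF g(1)] dvd_trans by blast
    then show ?thesis unfolding int_pow_int .
  qed
  then have "(g [^] d) [^] e = g" using g(1) by (simp add: nat_pow_pow)
  moreover have "(g [^] d) [^] e \<in> M"
    by (induction e) (use d in auto)
  ultimately show False using g(2) by simp
qed

text \<open>Since \<open>g\<close> normalizes \<open>M\<close>, the products \<open>m g\<^sup>i\<close> form a subgroup, which is all of \<open>G\<close>. The exponent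
\<open>i\<close> is determined modulo \<open>p\<close> by the preceding lemma, and it is additive.\<close>
lemma mod_character_of_cyclic_quotient:
  assumes p: "Factorial_Ring.prime p" "order G = p ^ k" "finite (carrier G)"
    and M: "subgroup M G" and g: "g \<in> carrier G" "g \<notin> M"
    and norm: "\<And>m. m \<in> M \<Longrightarrow> \<exists>m'\<in>M. g \<otimes> m = m' \<otimes> g"
    and gen: "\<And>U. subgroup U G \<Longrightarrow> M \<subseteq> U \<Longrightarrow> g \<in> U \<Longrightarrow> U = carrier G"
  shows "\<exists>\<chi>. mod_character p G \<chi> \<and> (\<forall>m\<in>M. [\<chi> m = 0] (mod int p)) \<and> [\<chi> g = 1] (mod int p)"
proof -
  interpret M: subgroup M G by fact
  define U where "U = {m \<otimes> g [^] (i::nat) | m i. m \<in> M}"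
  have norm_pow: "\<exists>m'\<in>M. g [^] (i::nat) \<otimes> m = m' \<otimes> g [^] i" if "m \<in> M" for m i
    using that
  proof (induction i arbitrary: m)
    case (Suc i)
    obtain m' where m': "m' \<in> M" "g \<otimes> m = m' \<otimes> g" using norm[OF Suc.prems] by blast
    obtain m'' where m'': "m'' \<in> M" "g [^] i \<otimes> m' = m'' \<otimes> g [^] i" using Suc.IH[OF m'(1)] by blast
    have "g [^] Suc i \<otimes> m = g [^] i \<otimes> (g \<otimes> m)" using g Suc.prems by (simp add: m_assoc)
    also have "\<dots> = (g [^] i \<otimes> m') \<otimes> g" using m' g by (simp add: m_assoc)
    also have "\<dots> = m'' \<otimes> g [^] Suc i" using m'' g by (simp add: m_assoc)
    finally show ?case using m'' by blast
  qed (auto intro: M.mem_carrier)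
  have mult: "\<exists>m''\<in>M. (m \<otimes> g [^] i) \<otimes> (m' \<otimes> g [^] j) = m'' \<otimes> g [^] (i + j)"
    if m: "m \<in> M" "m' \<in> M" for m m' and i j :: nat
  proof -
    obtain n where n: "n \<in> M" "g [^] i \<otimes> m' = n \<otimes> g [^] i" using norm_pow m by blast
    have "(m \<otimes> g [^] i) \<otimes> (m' \<otimes> g [^] j) = m \<otimes> ((g [^] i \<otimes> m') \<otimes> g [^] j)"
      using m g by (simp add: m_assoc)
    also have "\<dots> = (m \<otimes> n) \<otimes> (g [^] (i + j))"
      using m n g by (simp add: m_assoc nat_pow_mult)
    finally show ?thesis using m n by blast
  qed
  have "subgroup U G"
  proof (rule subgroup_if_finite_mult_closed[OF p(3)])
    show "U \<subseteq> carrier G" using g by (auto simp: U_def)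
    show "\<one> \<in> U" unfolding U_def using M.one_closed by (force intro!: exI[of _ "0::nat"] exI[of _ \<one>])
    show "x \<otimes> y \<in> U" if "x \<in> U" "y \<in> U" for x y
      using that mult unfolding U_def by blast
  qed
  moreover have "M \<subseteq> U"
  proof
    fix m assume "m \<in> M"
    moreover from this have "m = m \<otimes> g [^] (0::nat)" by simp
    ultimately show "m \<in> U" unfolding U_def by blast
  qed
  moreover have "g \<in> U"
  proof -
    have "g = \<one> \<otimes> g [^] (1::nat)" using g by simp
    then show ?thesis unfolding U_def using M.one_closed by blast
  qed
  ultimately have "U = carrier G" using gen by blast
  then have ex: "\<exists>i. \<exists>m\<in>M. x = m \<otimes> g [^] (i::nat)" if "x \<in> carrier G" for x
    using that unfolding U_def by blast
  have le: "[int i = int j] (mod int p)"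
    if m: "m \<in> M" "m' \<in> M" "m \<otimes> g [^] i = m' \<otimes> g [^] j" and ij: "i \<le> j" for m m' and i j :: nat
  proof -
    have "m \<otimes> g [^] i = (m' \<otimes> g [^] (j - i)) \<otimes> g [^] i"
      using m g ij by (simp add: m_assoc nat_pow_mult)
    then have "m = m' \<otimes> g [^] (j - i)" using m g by (metis M.mem_carrier m_closed nat_pow_closed right_cancel)
    then have "g [^] (j - i) = inv m' \<otimes> m" using m g inv_solve_left[of "g [^] (j - i)" m' m] by simp
    then have "g [^] (j - i) \<in> M" using m by simp
    then have "p dvd j - i" using p_group_power_congruence[OF p(1,2) M g] by blast
    then have "[j = i] (mod p)" using ij by (simp add: cong_altdef_nat)
    then show ?thesis by (simp add: cong_int_iff cong_sym)
  qed
  have unique: "[int i = int j] (mod int p)"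
    if "m \<in> M" "m' \<in> M" "m \<otimes> g [^] i = m' \<otimes> g [^] j" for m m' and i j :: nat
    using le[of m m' i j] le[of m' m j i] that by (cases "i \<le> j") (auto simp: cong_sym)
  \<comment> \<open>The exponent is determined only modulo \<open>p\<close>, so the choice does not matter.\<close>
  define e where "e x = (SOME i. \<exists>m\<in>M. x = m \<otimes> g [^] (i::nat))" for x
  have e: "\<exists>m\<in>M. x = m \<otimes> g [^] e x" if "x \<in> carrier G" for x
    unfolding e_def using ex[OF that] by (rule someI_ex)
  have e_eq: "[int (e (m \<otimes> g [^] i)) = int i] (mod int p)" if "m \<in> M" for m and i :: nat
    using e[of "m \<otimes> g [^] i"] that g unique by fastforce
  have "mod_character p G (\<lambda>x. int (e x))"
    unfolding mod_character_def
  proof (intro ballI)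
    fix x y assume "x \<in> carrier G" "y \<in> carrier G"
    then obtain m m' where m: "m \<in> M" "m' \<in> M" "x = m \<otimes> g [^] e x" "y = m' \<otimes> g [^] e y"
      using e by meson
    then obtain m'' where m'': "m'' \<in> M" "x \<otimes> y = m'' \<otimes> g [^] (e x + e y)" using mult by metis
    show "[int (e (x \<otimes> y)) = int (e x) + int (e y)] (mod int p)"
      using e_eq[OF m''(1), of "e x + e y"] m''(2) by simp
  qed
  moreover have "[int (e m) = 0] (mod int p)" if "m \<in> M" for m
    using e_eq[OF that, of 0] that by simp
  moreover have "[int (e g) = 1] (mod int p)"
    using e_eq[OF M.one_closed, of 1] g by simp
  ultimately show ?thesis by blast
qed

text \<open>A maximal proper subgroup containing \<open>M\<close> is normalized by some \<open>g\<close> outside it, and together with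
\<open>g\<close> it generates \<open>G\<close>; the exponent of \<open>g\<close> is the required homomorphism.\<close>
lemma p_group_mod_character_separates:
  assumes p: "Factorial_Ring.prime p" "finite_p_group p G"
    and M: "subgroup M G" "M \<noteq> carrier G"
  shows "\<exists>\<chi>. mod_character p G \<chi> \<and> (\<forall>m\<in>M. [\<chi> m = 0] (mod int p)) \<and>
    (\<exists>g\<in>carrier G. [\<chi> g = 1] (mod int p))"
proof -
  obtain k where k: "order G = p ^ k" and fin: "finite (carrier G)"
    using p(2) by (auto simp: finite_p_group_def)
  obtain M' where M': "subgroup M' G" "M \<subseteq> M'" "M' \<noteq> carrier G"
    and max: "\<And>U. subgroup U G \<Longrightarrow> M' \<subset> U \<Longrightarrow> U = carrier G"
    using maximal_proper_subgroup_exists[OF fin M] by blast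
  obtain g where g: "g \<in> carrier G" "g \<notin> M'" "\<And>m. m \<in> M' \<Longrightarrow> \<exists>m'\<in>M'. g \<otimes> m = m' \<otimes> g"
    using p_group_normalizer_grows[OF p M'(1,3)] by blast
  have gen: "U = carrier G" if "subgroup U G" "M' \<subseteq> U" "g \<in> U" for U
    using max[OF that(1)] that g(2) by blast
  have "\<exists>\<chi>. mod_character p G \<chi> \<and> (\<forall>m\<in>M'. [\<chi> m = 0] (mod int p)) \<and> [\<chi> g = 1] (mod int p)"
    by (rule mod_character_of_cyclic_quotient[OF p(1) k fin M'(1) g gen])
  then show ?thesis using M'(2) g(1) by blast
qed

section \<open>Exchange in generating sets, and kernels of rank-preserving quotients\<close>

text \<open>If no exchange were possible, then for each \<open>s \<in> S\<close> some homomorphism \<open>\<psi> s\<close> would kill \<open>x\<close> and all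
of \<open>S\<close> except \<open>s\<close>, where it can be scaled to take the value 1. Then \<open>\<chi> = (\<Sum>s\<in>S. \<chi> s * \<psi> s)\<close> on
the generators, hence on \<open>G\<close>, and the right-hand side vanishes at \<open>x\<close>.\<close>
lemma p_group_exchange:
  assumes p: "Factorial_Ring.prime p" "finite_p_group p G"
    and S: "S \<subseteq> carrier G" "finite S" "generate G S = carrier G"
    and x: "x \<in> carrier G" "mod_character p G \<chi>" "\<not> [\<chi> x = 0] (mod int p)"
  shows "\<exists>s\<in>S. generate G (insert x (S - {s})) = carrier G"
proof (rule ccontr)
  assume neg: "\<not> ?thesis"
  have "\<exists>\<psi>. mod_character p G \<psi> \<and> (\<forall>t\<in>insert x (S - {s}). [\<psi> t = 0] (mod int p)) \<and> [\<psi> s = 1] (mod int p)"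
    if s: "s \<in> S" for s
  proof -
    let ?M = "generate G (insert x (S - {s}))"
    have sub: "insert x (S - {s}) \<subseteq> carrier G" using S x by blast
    have "subgroup ?M G" "?M \<noteq> carrier G"
      using generate_is_subgroup[OF sub] neg s by auto
    then obtain \<psi> g where \<psi>: "mod_character p G \<psi>" "\<forall>m\<in>?M. [\<psi> m = 0] (mod int p)"
      and g: "g \<in> carrier G" "[\<psi> g = 1] (mod int p)"
      using p_group_mod_character_separates[OF p] by blast
    have van: "[\<psi> t = 0] (mod int p)" if "t \<in> insert x (S - {s})" for t
      using \<psi>(2) generate.incl[OF that] by blast
    have "\<not> [\<psi> s = 0] (mod int p)"
    proof
      assume "[\<psi> s = 0] (mod int p)"
      then have "[\<psi> g = 0] (mod int p)"
        using van g(1) S mod_character_vanishes_on_generate[OF \<psi>(1) S(1), of g] by blast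
      then have "[1 = 0] (mod int p)" using g(2) by (metis cong_sym cong_trans)
      then show False using prime_gt_1_nat[OF p(1)] by (simp add: cong_def)
    qed
    then have "coprime (\<psi> s) (int p)"
      using p(1) prime_imp_coprime[of "int p" "\<psi> s"] by (simp add: cong_0_iff coprime_commute)
    then obtain c where c: "[\<psi> s * c = 1] (mod int p)" using cong_solve_coprime_int by blast
    have "mod_character p G (\<lambda>x. c * \<psi> x)" using \<psi>(1) by (rule mod_character_scaled)
    moreover have "[c * \<psi> t = 0] (mod int p)" if "t \<in> insert x (S - {s})" for t
      using cong_scalar_left[OF van[OF that], of c] by simp
    ultimately show ?thesis using c by (intro exI[of _ "\<lambda>x. c * \<psi> x"]) (simp add: mult.commute)
  qed
  then obtain \<psi> where \<psi>: "\<And>s. s \<in> S \<Longrightarrow> mod_character p G (\<psi> s)"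
    "\<And>s t. s \<in> S \<Longrightarrow> t \<in> insert x (S - {s}) \<Longrightarrow> [\<psi> s t = 0] (mod int p)"
    "\<And>s. s \<in> S \<Longrightarrow> [\<psi> s s = 1] (mod int p)"
    by metis
  define \<theta> where "\<theta> y = \<chi> y - (\<Sum>s\<in>S. \<chi> s * \<psi> s y)" for y
  have \<theta>: "mod_character p G \<theta>"
    unfolding \<theta>_def
    by (intro mod_character_diff x mod_character_sum mod_character_scaled \<psi>)
  have "[\<theta> t = 0] (mod int p)" if t: "t \<in> S" for t
  proof -
    have "[(\<Sum>s\<in>S. \<chi> s * \<psi> s t) = (\<Sum>s\<in>S. \<chi> s * (if s = t then 1 else 0))] (mod int p)"
      using \<psi> t by (intro cong_sum cong_scalar_left) auto
    also have "(\<Sum>s\<in>S. \<chi> s * (if s = t then 1 else 0)) = \<chi> t"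
      using t S(2) by (simp add: if_distrib cong: if_cong)
    finally have "[\<chi> t - (\<Sum>s\<in>S. \<chi> s * \<psi> s t) = \<chi> t - \<chi> t] (mod int p)"
      by (intro cong_diff) auto
    then show ?thesis by (simp add: \<theta>_def)
  qed
  then have 0: "[\<theta> x = 0] (mod int p)"
    using mod_character_vanishes_on_generate[OF \<theta> S(1), of x] S(3) x(1) by blast
  have "[(\<Sum>s\<in>S. \<chi> s * \<psi> s x) = (\<Sum>s\<in>S. \<chi> s * 0)] (mod int p)"
    using \<psi>(2) by (intro cong_sum cong_scalar_left) auto
  then have "[\<chi> x - (\<Sum>s\<in>S. \<chi> s * \<psi> s x) = \<chi> x - 0] (mod int p)"
    by (intro cong_diff) auto
  then have "[\<theta> x = \<chi> x] (mod int p)" by (simp add: \<theta>_def)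
  then show False using 0 x(3) by (metis cong_sym cong_trans)
qed

end

lemma generate_hom_image_surj:
  assumes "group G" "group K" "h \<in> hom G K" "h ` carrier G = carrier K"
    and "S \<subseteq> carrier G" "generate G S = carrier G"
  shows "generate K (h ` S) = carrier K"
proof -
  interpret group_hom G K h
    using assms by (simp add: group_hom_def group_hom_axioms_def)
  show ?thesis using generate_img[OF assms(5)] assms(4,6) by simp
qed

lemma group_rank_attained:
  assumes "group G" "finite (carrier G)"
  obtains S where "S \<subseteq> carrier G" "finite S" "card S = group_rank G" "generate G S = carrier G"
proof -
  interpret group G by fact
  have "\<exists>n S. S \<subseteq> carrier G \<and> finite S \<and> card S = n \<and> generate G S = carrier G"
    using assms(2) generate_incl[of "carrier G"] generate.incl[of _ "carrier G" G] by blast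
  then have "\<exists>S. S \<subseteq> carrier G \<and> finite S \<and> card S = group_rank G \<and> generate G S = carrier G"
    unfolding group_rank_def by (rule LeastI_ex)
  then show ?thesis using that by blast
qed

lemma group_rank_le:
  assumes "S \<subseteq> carrier G" "finite S" "generate G S = carrier G"
  shows "group_rank G \<le> card S"
  unfolding group_rank_def using assms by (intro Least_le) blast

lemma group_rank_surj_hom_le:
  assumes "group G" "finite (carrier G)" "group K" "h \<in> hom G K" "h ` carrier G = carrier K"
  shows "group_rank K \<le> group_rank G"
proof -
  obtain S where S: "S \<subseteq> carrier G" "finite S" "card S = group_rank G" "generate G S = carrier G"
    using group_rank_attained[OF assms(1,2)] by blast
  have "group_rank K \<le> card (h ` S)"
    using generate_hom_image_surj[OF assms(1,3-5) S(1,4)] S(1,2) assms(4)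
    by (intro group_rank_le) (auto simp: hom_def)
  also have "\<dots> \<le> group_rank G" using card_image_le[OF S(2), of h] S(3) by simp
  finally show ?thesis .
qed

lemma group_rank_iso:
  assumes "group G" "finite (carrier G)" "group K" "G \<cong> K"
  shows "group_rank G = group_rank K"
proof (rule antisym)
  obtain h where h: "h \<in> iso G K" using assms(4) by (auto simp: is_iso_def)
  obtain h' where h': "h' \<in> iso K G"
    using group.iso_sym[OF assms(1,4)] by (auto simp: is_iso_def)
  show "group_rank K \<le> group_rank G"
    using h assms by (intro group_rank_surj_hom_le[of G K h]) (auto simp: iso_def bij_betw_def)
  show "group_rank G \<le> group_rank K"
    using h' assms iso_finite[OF assms(4)]
    by (intro group_rank_surj_hom_le[of K G h']) (auto simp: iso_def bij_betw_def)
qed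

text \<open>If \<open>\<chi> x\<close> were nonzero, \<open>x\<close> could replace a member of a minimal generating set of \<open>G\<close>. As \<open>x\<close> has
trivial image in \<open>K\<close>, the remaining members would already generate \<open>K\<close>, and the rank would drop.\<close>
lemma mod_character_vanishes_on_rank_preserving_kernel:
  assumes p: "Factorial_Ring.prime p" "finite_p_group p G" and K: "group K"
    and h: "h \<in> hom G K" "h ` carrier G = carrier K" and rank: "group_rank K = group_rank G"
    and \<chi>: "mod_character p G \<chi>" and x: "x \<in> carrier G" "h x = \<one>\<^bsub>K\<^esub>"
  shows "[\<chi> x = 0] (mod int p)"
proof (rule ccontr)
  assume nz: "\<not> ?thesis"
  have G: "group G" and fin: "finite (carrier G)" using p(2) by (auto simp: finite_p_group_def)
  interpret G: group G by fact
  interpret K: group K by fact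
  obtain S where S: "S \<subseteq> carrier G" "finite S" "card S = group_rank G" "generate G S = carrier G"
    using group_rank_attained[OF G fin] by blast
  obtain s where s: "s \<in> S" "generate G (insert x (S - {s})) = carrier G"
    using G.p_group_exchange[OF p S(1,2,4) x(1) \<chi> nz] by blast
  let ?T = "h ` (S - {s})"
  have TK: "?T \<subseteq> carrier K" using S(1) h(2) by blast
  have "carrier K = generate K (insert \<one>\<^bsub>K\<^esub> ?T)"
    using generate_hom_image_surj[OF G K h _ s(2)] S(1) x by auto
  also have "\<dots> \<subseteq> generate K ?T"
    by (intro K.generate_subgroup_incl K.generate_is_subgroup TK)
      (auto intro: generate.one generate.incl)
  finally have "generate K ?T = carrier K"
    using K.generate_incl[OF TK] by blast
  then have "group_rank K \<le> card ?T"
    using TK S(2) by (intro group_rank_le) auto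
  also have "\<dots> < group_rank G"
    using card_image_le[of "S - {s}" h] S(2,3) s(1) card_Diff1_less[OF S(2) s(1)] by simp
  finally show False using rank by simp
qed

section \<open>The invariant of the family\<close>

text \<open>Here \<open>y\<close> ranges over the conjugates \<open>g a g\<inverse>\<close>, written without an inverse because inverses are
unwieldy in wreath products. The condition says that the normal closure of \<open>a\<close> is abelian.\<close>
definition commutes_with_conjugates :: "('a, 'b) monoid_scheme \<Rightarrow> 'a \<Rightarrow> bool" where
  "commutes_with_conjugates G a \<longleftrightarrow>
    (\<forall>g\<in>carrier G. \<forall>y\<in>carrier G. y \<otimes>\<^bsub>G\<^esub> g = g \<otimes>\<^bsub>G\<^esub> a \<longrightarrow> y \<otimes>\<^bsub>G\<^esub> a = a \<otimes>\<^bsub>G\<^esub> y)"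

text \<open>In a finite \<open>p\<close>-group, an element lies outside the Frattini subgroup if and only if some
homomorphism to the integers modulo \<open>p\<close> does not vanish on it.\<close>
definition abelian_closure_outside_frattini :: "nat \<Rightarrow> ('a, 'b) monoid_scheme \<Rightarrow> bool" where
  "abelian_closure_outside_frattini p G \<longleftrightarrow>
    (\<exists>a\<in>carrier G. commutes_with_conjugates G a \<and>
      (\<exists>\<chi>. mod_character p G \<chi> \<and> \<not> [\<chi> a = 0] (mod int p)))"

text \<open>Homomorphisms to the integers modulo \<open>p\<close> that all vanish on the kernel descend to the quotient.
For finite \<open>p\<close>-groups the assumption on the kernel says that it lies in the Frattini subgroup.\<close>
lemma abelian_closure_outside_frattini_surj_hom:
  assumes G: "group G" and K: "group K" and h: "h \<in> hom G K" "h ` carrier G = carrier K"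
    and ker: "\<And>\<chi> x. \<lbrakk>mod_character p G \<chi>; x \<in> carrier G; h x = \<one>\<^bsub>K\<^esub>\<rbrakk> \<Longrightarrow> [\<chi> x = 0] (mod int p)"
    and J: "abelian_closure_outside_frattini p G"
  shows "abelian_closure_outside_frattini p K"
proof -
  interpret group_hom G K h
    using assms by (simp add: group_hom_def group_hom_axioms_def)
  obtain a \<chi> where a: "a \<in> carrier G" "commutes_with_conjugates G a"
    and \<chi>: "mod_character p G \<chi>" "\<not> [\<chi> a = 0] (mod int p)"
    using J unfolding abelian_closure_outside_frattini_def by blast
  have add: "[\<chi> (x \<otimes>\<^bsub>G\<^esub> y) = \<chi> x + \<chi> y] (mod int p)" if "x \<in> carrier G" "y \<in> carrier G" for x y
    using \<chi>(1) that by (simp add: mod_character_def)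
  have const: "[\<chi> x = \<chi> y] (mod int p)" if xy: "x \<in> carrier G" "y \<in> carrier G" "h x = h y" for x y
  proof -
    let ?z = "x \<otimes>\<^bsub>G\<^esub> inv\<^bsub>G\<^esub> y"
    have "[\<chi> ?z = 0] (mod int p)" using xy by (intro ker[OF \<chi>(1)]) auto
    then have "[\<chi> ?z + \<chi> y = 0 + \<chi> y] (mod int p)" by (intro cong_add) auto
    moreover have "[\<chi> (?z \<otimes>\<^bsub>G\<^esub> y) = \<chi> ?z + \<chi> y] (mod int p)" using xy by (intro add) auto
    moreover have "?z \<otimes>\<^bsub>G\<^esub> y = x" using xy by (simp add: G.m_assoc)
    ultimately show ?thesis by (metis add_0 cong_trans)
  qed
  \<comment> \<open>Any section of \<open>h\<close> will do, because \<open>\<chi>\<close> is constant on the fibres modulo \<open>p\<close>.\<close>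
  define s where "s = inv_into (carrier G) h"
  have s: "s k \<in> carrier G" "h (s k) = k" if "k \<in> carrier K" for k
    using that h(2) by (auto simp: s_def inv_into_into f_inv_into_f)
  have "mod_character p K (\<lambda>k. \<chi> (s k))"
    unfolding mod_character_def
  proof (intro ballI)
    fix k l assume kl: "k \<in> carrier K" "l \<in> carrier K"
    have "[\<chi> (s (k \<otimes>\<^bsub>K\<^esub> l)) = \<chi> (s k \<otimes>\<^bsub>G\<^esub> s l)] (mod int p)"
      using kl s by (intro const) auto
    then show "[\<chi> (s (k \<otimes>\<^bsub>K\<^esub> l)) = \<chi> (s k) + \<chi> (s l)] (mod int p)"
      using add[of "s k" "s l"] s kl cong_trans by blast
  qed
  moreover have "\<not> [\<chi> (s (h a)) = 0] (mod int p)"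
    using const[of "s (h a)" a] s[of "h a"] a(1) \<chi>(2) by (metis cong_sym cong_trans hom_closed)
  moreover have "commutes_with_conjugates K (h a)"
    unfolding commutes_with_conjugates_def
  proof (intro ballI impI)
    fix g y assume gy: "g \<in> carrier K" "y \<in> carrier K" "y \<otimes>\<^bsub>K\<^esub> g = g \<otimes>\<^bsub>K\<^esub> h a"
    let ?y = "s g \<otimes>\<^bsub>G\<^esub> a \<otimes>\<^bsub>G\<^esub> inv\<^bsub>G\<^esub> (s g)"
    have y: "y = h ?y"
      using gy s a by (simp add: H.inv_solve_right)
    have "?y \<otimes>\<^bsub>G\<^esub> s g = s g \<otimes>\<^bsub>G\<^esub> a" using s gy a by (simp add: G.m_assoc)
    then have "?y \<otimes>\<^bsub>G\<^esub> a = a \<otimes>\<^bsub>G\<^esub> ?y"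
      using a s gy unfolding commutes_with_conjugates_def by (metis G.inv_closed G.m_closed)
    then have "h (?y \<otimes>\<^bsub>G\<^esub> a) = h (a \<otimes>\<^bsub>G\<^esub> ?y)" by simp
    then show "y \<otimes>\<^bsub>K\<^esub> h a = h a \<otimes>\<^bsub>K\<^esub> y"
      unfolding y using a s[OF gy(1)] by (simp add: hom_mult)
  qed
  moreover have "h a \<in> carrier K" using a(1) by simp
  ultimately show ?thesis
    unfolding abelian_closure_outside_frattini_def by blast
qed

lemma abelian_closure_outside_frattini_iso:
  assumes "group G" "group K" "G \<cong> K" "abelian_closure_outside_frattini p G"
  shows "abelian_closure_outside_frattini p K"
proof -
  interpret G: group G by fact
  obtain h where h: "h \<in> iso G K" using assms(3) by (auto simp: is_iso_def)
  show ?thesis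
  proof (rule abelian_closure_outside_frattini_surj_hom[OF assms(1,2) _ _ _ assms(4)])
    show "h \<in> hom G K" "h ` carrier G = carrier K" using h by (auto simp: iso_def bij_betw_def)
    fix \<chi> x assume \<chi>: "mod_character p G \<chi>" and x: "x \<in> carrier G" "h x = \<one>\<^bsub>K\<^esub>"
    have "x = \<one>\<^bsub>G\<^esub>"
      using h x hom_one[OF _ assms(1,2), of h] by (auto simp: iso_def bij_betw_def inj_on_def)
    then show "[\<chi> x = 0] (mod int p)" using G.mod_character_one[OF \<chi>] by simp
  qed
qed

lemma abelian_closure_outside_frattini_abelian:
  assumes p: "Factorial_Ring.prime p" "finite_p_group p G"
    and comm: "comm_group G" and nontriv: "carrier G \<noteq> {\<one>\<^bsub>G\<^esub>}"
  shows "abelian_closure_outside_frattini p G"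
proof -
  interpret comm_group G by fact
  obtain \<chi> g where \<chi>: "mod_character p G \<chi>" "g \<in> carrier G" "[\<chi> g = 1] (mod int p)"
    using p_group_mod_character_separates[OF p triv_subgroup nontriv[symmetric]] by blast
  have "\<not> [\<chi> g = 0] (mod int p)"
  proof
    assume "[\<chi> g = 0] (mod int p)"
    then have "[1 = 0] (mod int p)" using \<chi>(3) by (metis cong_sym cong_trans)
    then show False using prime_gt_1_nat[OF p(1)] by (simp add: cong_def)
  qed
  moreover have "commutes_with_conjugates G g"
    using \<chi>(2) by (auto simp: commutes_with_conjugates_def m_comm)
  ultimately show ?thesis using \<chi> by (auto simp: abelian_closure_outside_frattini_def)
qed

lemma abelian_closure_outside_frattini_direct_product_left:
  assumes G: "group G" and H: "group H" and J: "abelian_closure_outside_frattini p G"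
  shows "abelian_closure_outside_frattini p (G \<times>\<times> H)"
proof -
  interpret H: group H by fact
  obtain a \<chi> where a: "a \<in> carrier G" "commutes_with_conjugates G a"
    and \<chi>: "mod_character p G \<chi>" "\<not> [\<chi> a = 0] (mod int p)"
    using J unfolding abelian_closure_outside_frattini_def by blast
  have "commutes_with_conjugates (G \<times>\<times> H) (a, \<one>\<^bsub>H\<^esub>)"
    unfolding commutes_with_conjugates_def
  proof (intro ballI impI)
    fix g y assume g: "g \<in> carrier (G \<times>\<times> H)" and y: "y \<in> carrier (G \<times>\<times> H)"
      and eq: "y \<otimes>\<^bsub>G \<times>\<times> H\<^esub> g = g \<otimes>\<^bsub>G \<times>\<times> H\<^esub> (a, \<one>\<^bsub>H\<^esub>)"
    obtain g1 g2 y1 y2 where gy: "g = (g1, g2)" "y = (y1, y2)" by (meson surj_pair)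
    have cl: "g1 \<in> carrier G" "y1 \<in> carrier G" "y2 \<in> carrier H"
      using g y by (simp_all add: gy DirProd_def)
    have "y1 \<otimes>\<^bsub>G\<^esub> g1 = g1 \<otimes>\<^bsub>G\<^esub> a" using eq by (simp add: gy)
    then have "y1 \<otimes>\<^bsub>G\<^esub> a = a \<otimes>\<^bsub>G\<^esub> y1"
      using a(2) cl unfolding commutes_with_conjugates_def by blast
    then show "y \<otimes>\<^bsub>G \<times>\<times> H\<^esub> (a, \<one>\<^bsub>H\<^esub>) = (a, \<one>\<^bsub>H\<^esub>) \<otimes>\<^bsub>G \<times>\<times> H\<^esub> y"
      using cl by (simp add: gy)
  qed
  moreover have "mod_character p (G \<times>\<times> H) (\<lambda>z. \<chi> (fst z))"
    unfolding mod_character_def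
  proof (intro ballI)
    fix x y assume "x \<in> carrier (G \<times>\<times> H)" "y \<in> carrier (G \<times>\<times> H)"
    then show "[\<chi> (fst (x \<otimes>\<^bsub>G \<times>\<times> H\<^esub> y)) = \<chi> (fst x) + \<chi> (fst y)] (mod int p)"
      using \<chi>(1) by (cases x; cases y) (simp add: mod_character_def)
  qed
  moreover have "(a, \<one>\<^bsub>H\<^esub>) \<in> carrier (G \<times>\<times> H)" using a(1) by (simp add: DirProd_def)
  moreover have "\<not> [\<chi> (fst (a, \<one>\<^bsub>H\<^esub>)) = 0] (mod int p)" using \<chi>(2) by simp
  ultimately show ?thesis
    unfolding abelian_closure_outside_frattini_def by blast
qed

lemma abelian_closure_outside_frattini_direct_product:
  assumes G: "group G" and H: "group H"
    and J: "abelian_closure_outside_frattini p G \<or> abelian_closure_outside_frattini p H"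
  shows "abelian_closure_outside_frattini p (G \<times>\<times> H)"
  using J
proof
  assume "abelian_closure_outside_frattini p H"
  then have "abelian_closure_outside_frattini p (H \<times>\<times> G)"
    by (rule abelian_closure_outside_frattini_direct_product_left[OF H G])
  moreover have "H \<times>\<times> G \<cong> G \<times>\<times> H" by (rule DirProd_commute_iso)
  ultimately show ?thesis
    using abelian_closure_outside_frattini_iso[OF DirProd_group[OF H G] DirProd_group[OF G H]] by blast
qed (rule abelian_closure_outside_frattini_direct_product_left[OF G H])

lemma carrier_regular_wreath:
  "carrier (regular_wreath H G) = (carrier G \<rightarrow>\<^sub>E carrier H) \<times> carrier G"
  by (simp add: regular_wreath_def semidirect_product_def)

lemma mult_regular_wreath:
  assumes "group G" "g \<in> carrier G"
  shows "(u, g) \<otimes>\<^bsub>regular_wreath H G\<^esub> (v, h) =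
    ((\<lambda>x\<in>carrier G. u x \<otimes>\<^bsub>H\<^esub> v (inv\<^bsub>G\<^esub> g \<otimes>\<^bsub>G\<^esub> x)), g \<otimes>\<^bsub>G\<^esub> h)"
  by (simp add: regular_wreath_def semidirect_product_def cong: restrict_cong)

text \<open>Summing \<open>\<chi>\<close> over all coordinates is additive because the action of \<open>G\<close> only permutes the
coordinates.\<close>
lemma mod_character_regular_wreath_base:
  assumes H: "group H" and G: "group G" "finite (carrier G)" and \<chi>: "mod_character p H \<chi>"
  shows "mod_character p (regular_wreath H G) (\<lambda>z. \<Sum>x\<in>carrier G. \<chi> (fst z x))"
  unfolding mod_character_def
proof (intro ballI)
  interpret H: group H by fact
  interpret G: group G by fact
  fix y z assume "y \<in> carrier (regular_wreath H G)" "z \<in> carrier (regular_wreath H G)"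
  then obtain u g v h where yz: "y = (u, g)" "z = (v, h)" and g: "g \<in> carrier G" "h \<in> carrier G"
    and u: "u \<in> carrier G \<rightarrow>\<^sub>E carrier H" "v \<in> carrier G \<rightarrow>\<^sub>E carrier H"
    unfolding carrier_regular_wreath by blast
  have "(\<Sum>x\<in>carrier G. \<chi> (fst (y \<otimes>\<^bsub>regular_wreath H G\<^esub> z) x)) =
      (\<Sum>x\<in>carrier G. \<chi> (u x \<otimes>\<^bsub>H\<^esub> v (inv\<^bsub>G\<^esub> g \<otimes>\<^bsub>G\<^esub> x)))"
    using g by (simp add: yz mult_regular_wreath[OF G(1)])
  also have "[\<dots> = (\<Sum>x\<in>carrier G. \<chi> (u x) + \<chi> (v (inv\<^bsub>G\<^esub> g \<otimes>\<^bsub>G\<^esub> x)))] (mod int p)"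
  proof (rule cong_sum)
    fix x assume "x \<in> carrier G"
    then have "u x \<in> carrier H" "v (inv\<^bsub>G\<^esub> g \<otimes>\<^bsub>G\<^esub> x) \<in> carrier H"
      using u g by (auto simp: PiE_iff)
    then show "[\<chi> (u x \<otimes>\<^bsub>H\<^esub> v (inv\<^bsub>G\<^esub> g \<otimes>\<^bsub>G\<^esub> x)) = \<chi> (u x) + \<chi> (v (inv\<^bsub>G\<^esub> g \<otimes>\<^bsub>G\<^esub> x))] (mod int p)"
      using \<chi> by (simp add: mod_character_def)
  qed
  also have "(\<Sum>x\<in>carrier G. \<chi> (u x) + \<chi> (v (inv\<^bsub>G\<^esub> g \<otimes>\<^bsub>G\<^esub> x))) =
      (\<Sum>x\<in>carrier G. \<chi> (u x)) + (\<Sum>x\<in>carrier G. \<chi> (v (inv\<^bsub>G\<^esub> g \<otimes>\<^bsub>G\<^esub> x)))"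
    by (simp add: sum.distrib)
  also have "(\<Sum>x\<in>carrier G. \<chi> (v (inv\<^bsub>G\<^esub> g \<otimes>\<^bsub>G\<^esub> x))) = (\<Sum>x\<in>carrier G. \<chi> (v x))"
    by (rule sum.reindex_bij_witness[of _ "\<lambda>x. g \<otimes>\<^bsub>G\<^esub> x" "\<lambda>x. inv\<^bsub>G\<^esub> g \<otimes>\<^bsub>G\<^esub> x"])
      (use g in \<open>auto simp: G.m_assoc[symmetric]\<close>)
  finally show "[(\<Sum>x\<in>carrier G. \<chi> (fst (y \<otimes>\<^bsub>regular_wreath H G\<^esub> z) x)) =
      (\<Sum>x\<in>carrier G. \<chi> (fst y x)) + (\<Sum>x\<in>carrier G. \<chi> (fst z x))] (mod int p)"
    by (simp add: yz)
qed

text \<open>The witness has a single nontrivial entry \<open>a\<close>, at the coordinate \<open>\<one>\<close>. A conjugate of it again has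
a single nontrivial entry, a conjugate of \<open>a\<close>, possibly at another coordinate; either way
the two commute.\<close>
lemma abelian_closure_outside_frattini_regular_wreath_base:
  assumes H: "group H" and G: "group G" "finite (carrier G)"
    and J: "abelian_closure_outside_frattini p H"
  shows "abelian_closure_outside_frattini p (regular_wreath H G)"
proof -
  interpret H: group H by fact
  interpret G: group G by fact
  let ?W = "regular_wreath H G"
  obtain a \<chi> where a: "a \<in> carrier H" "commutes_with_conjugates H a"
    and \<chi>: "mod_character p H \<chi>" "\<not> [\<chi> a = 0] (mod int p)"
    using J unfolding abelian_closure_outside_frattini_def by blast
  define f where "f = (\<lambda>x\<in>carrier G. if x = \<one>\<^bsub>G\<^esub> then a else \<one>\<^bsub>H\<^esub>)"
  have f: "f \<in> carrier G \<rightarrow>\<^sub>E carrier H" using a by (auto simp: f_def)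
  have "[(\<Sum>x\<in>carrier G. \<chi> (f x)) = (\<Sum>x\<in>carrier G. if x = \<one>\<^bsub>G\<^esub> then \<chi> a else 0)] (mod int p)"
    using H.mod_character_one[OF \<chi>(1)] by (intro cong_sum) (auto simp: f_def)
  also have "(\<Sum>x\<in>carrier G. if x = \<one>\<^bsub>G\<^esub> then \<chi> a else 0) = \<chi> a"
    using G(2) by simp
  finally have nz: "\<not> [(\<Sum>x\<in>carrier G. \<chi> (f x)) = 0] (mod int p)"
    using \<chi>(2) by (metis cong_sym cong_trans)
  have "commutes_with_conjugates ?W (f, \<one>\<^bsub>G\<^esub>)"
    unfolding commutes_with_conjugates_def
  proof (intro ballI impI)
    fix c y assume "c \<in> carrier ?W" "y \<in> carrier ?W"
      and eq: "y \<otimes>\<^bsub>?W\<^esub> c = c \<otimes>\<^bsub>?W\<^esub> (f, \<one>\<^bsub>G\<^esub>)"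
    then obtain u h w k where cy: "c = (u, h)" "y = (w, k)" and h: "h \<in> carrier G" "k \<in> carrier G"
      and u: "u \<in> carrier G \<rightarrow>\<^sub>E carrier H" "w \<in> carrier G \<rightarrow>\<^sub>E carrier H"
      unfolding carrier_regular_wreath by blast
    have ucl: "u x \<in> carrier H" "w x \<in> carrier H" if "x \<in> carrier G" for x
      using u that by auto
    have "k \<otimes>\<^bsub>G\<^esub> h = h"
      using eq h by (simp add: cy mult_regular_wreath[OF G(1)])
    then have k: "k = \<one>\<^bsub>G\<^esub>" using h by simp
    have conj: "w x \<otimes>\<^bsub>H\<^esub> u x = u x \<otimes>\<^bsub>H\<^esub> f (inv\<^bsub>G\<^esub> h \<otimes>\<^bsub>G\<^esub> x)" if "x \<in> carrier G" for x
      using eq h that k by (auto simp: cy mult_regular_wreath[OF G(1)] fun_eq_iff dest!: spec[of _ x])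
    have "w x \<otimes>\<^bsub>H\<^esub> f x = f x \<otimes>\<^bsub>H\<^esub> w x" if x: "x \<in> carrier G" for x
    proof (cases "x = \<one>\<^bsub>G\<^esub>")
      case False
      then show ?thesis using ucl x by (simp add: f_def)
    next
      case one: True
      then have fx: "f x = a" by (simp add: f_def)
      show ?thesis
      proof (cases "h = \<one>\<^bsub>G\<^esub>")
        case True
        then have "w x \<otimes>\<^bsub>H\<^esub> u x = u x \<otimes>\<^bsub>H\<^esub> a" using conj[OF x] one fx by simp
        then show ?thesis using a(2) ucl[OF x] unfolding commutes_with_conjugates_def fx by blast
      next
        case False
        then have "f (inv\<^bsub>G\<^esub> h \<otimes>\<^bsub>G\<^esub> x) = \<one>\<^bsub>H\<^esub>" using h one by (auto simp: f_def)
        then have "w x \<otimes>\<^bsub>H\<^esub> u x = u x" using conj[OF x] ucl x by simp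
        then have "w x = \<one>\<^bsub>H\<^esub>" using ucl x by simp
        then show ?thesis using a fx by simp
      qed
    qed
    then show "y \<otimes>\<^bsub>?W\<^esub> (f, \<one>\<^bsub>G\<^esub>) = (f, \<one>\<^bsub>G\<^esub>) \<otimes>\<^bsub>?W\<^esub> y"
      using h ucl by (simp add: cy k mult_regular_wreath[OF G(1)] cong: restrict_cong)
  qed
  moreover have "(f, \<one>\<^bsub>G\<^esub>) \<in> carrier ?W" using f by (simp add: carrier_regular_wreath)
  moreover have "\<not> [(\<Sum>x\<in>carrier G. \<chi> (fst (f, \<one>\<^bsub>G\<^esub>) x)) = 0] (mod int p)" using nz by simp
  ultimately show ?thesis
    using mod_character_regular_wreath_base[OF H G \<chi>(1)]
    unfolding abelian_closure_outside_frattini_def by blast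
qed

text \<open>When the base is trivial, the invariant of the wreath product has to come from the top group.\<close>
lemma regular_wreath_trivial_base_iso:
  assumes H: "group H" and triv: "carrier H = {\<one>\<^bsub>H\<^esub>}" and G: "group G"
  shows "G \<cong> regular_wreath H G"
proof -
  interpret H: group H by fact
  interpret G: group G by fact
  let ?u = "\<lambda>x\<in>carrier G. \<one>\<^bsub>H\<^esub>"
  have "carrier G \<rightarrow>\<^sub>E carrier H = {?u}"
    by (simp add: triv PiE_over_singleton_iff)
  then have "carrier (regular_wreath H G) = {?u} \<times> carrier G"
    by (simp add: carrier_regular_wreath)
  then have "bij_betw (\<lambda>g. (?u, g)) (carrier G) (carrier (regular_wreath H G))"
    by (auto simp: bij_betw_def inj_on_def)
  moreover have "(\<lambda>g. (?u, g)) \<in> hom G (regular_wreath H G)"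
  proof (rule homI)
    show "(?u, g) \<in> carrier (regular_wreath H G)" if "g \<in> carrier G" for g
      using that by (simp add: carrier_regular_wreath)
    show "(?u, g \<otimes>\<^bsub>G\<^esub> h) = (?u, g) \<otimes>\<^bsub>regular_wreath H G\<^esub> (?u, h)"
      if "g \<in> carrier G" "h \<in> carrier G" for g h
      using that by (simp add: mult_regular_wreath[OF G] cong: restrict_cong)
  qed
  ultimately show ?thesis by (intro is_isoI) (simp add: iso_def)
qed

lemma trivial_carrier_iso:
  assumes "group G" "group K" "K \<cong> G" "carrier G = {\<one>\<^bsub>G\<^esub>}"
  shows "carrier K = {\<one>\<^bsub>K\<^esub>}"
proof -
  interpret K: group K by fact
  have "card (carrier K) = 1" using iso_same_card[OF assms(3)] assms(4) by simp
  then obtain z where z: "carrier K = {z}" by (rule card_1_singletonE)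
  moreover have "\<one>\<^bsub>K\<^esub> = z" using K.one_closed unfolding z by simp
  ultimately show ?thesis by simp
qed

text \<open>Each closure rule preserves the invariant; in the quotient rule, equality of ranks puts the
kernel into the Frattini subgroup.\<close>
lemma wreath_family_abelian_closure_outside_frattini:
  assumes "wreath_family p K" and p: "Factorial_Ring.prime p"
  shows "carrier K = {\<one>\<^bsub>K\<^esub>} \<or> abelian_closure_outside_frattini p K"
  using assms(1)
proof (induction rule: wreath_family.induct)
  case (cyclic K k)
  then have "finite_p_group p K" by (auto simp: finite_p_group_def)
  then show ?case
    using abelian_closure_outside_frattini_abelian[OF p] cyclic
      group.cyclic_imp_abelian_group[of K] by blast
next
  case (iso G K)
  have G: "group G" using wreath_family_finite_p_group[OF iso.hyps(1) p] by (simp add: finite_p_group_def)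
  show ?case
    using iso G trivial_carrier_iso[OF G iso.hyps(2,3)]
      abelian_closure_outside_frattini_iso[OF G iso.hyps(2) group.iso_sym[OF iso.hyps(2,3)]] by blast
next
  case (direct_product G H K)
  have G: "group G" and H: "group H"
    using wreath_family_finite_p_group[OF _ p] direct_product.hyps by (auto simp: finite_p_group_def)
  have GH: "group (G \<times>\<times> H)" using G H by (simp add: DirProd_group)
  note iso_back = group.iso_sym[OF direct_product.hyps(3,4)]
  show ?case
  proof (cases "abelian_closure_outside_frattini p G \<or> abelian_closure_outside_frattini p H")
    case True
    then show ?thesis
      using abelian_closure_outside_frattini_iso[OF GH direct_product.hyps(3) iso_back]
        abelian_closure_outside_frattini_direct_product[OF G H] by blast
  next
    case False
    then have "carrier (G \<times>\<times> H) = {\<one>\<^bsub>G \<times>\<times> H\<^esub>}"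
      using direct_product.IH by (simp add: DirProd_def)
    then show ?thesis using trivial_carrier_iso[OF GH direct_product.hyps(3,4)] by blast
  qed
next
  case (wreath_product H G K)
  have G: "group G" "finite (carrier G)" and H: "group H"
    using wreath_family_finite_p_group[OF _ p] wreath_product.hyps by (auto simp: finite_p_group_def)
  have W: "group (regular_wreath H G)" using regular_wreath_group[OF H G(1)] .
  note iso_back = group.iso_sym[OF wreath_product.hyps(3,4)]
  show ?case
  proof (cases "carrier H = {\<one>\<^bsub>H\<^esub>}")
    case True
    then have GW: "G \<cong> regular_wreath H G" using regular_wreath_trivial_base_iso[OF H _ G(1)] by blast
    then have GK: "G \<cong> K" using iso_back iso_trans by blast
    have KG: "K \<cong> G" using group.iso_sym[OF G(1) GK] .
    show ?thesis
      using wreath_product.IH(2) trivial_carrier_iso[OF G(1) wreath_product.hyps(3) KG]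
        abelian_closure_outside_frattini_iso[OF G(1) wreath_product.hyps(3) GK] by blast
  next
    case False
    then have "abelian_closure_outside_frattini p (regular_wreath H G)"
      using wreath_product.IH(1) abelian_closure_outside_frattini_regular_wreath_base[OF H G] by blast
    then show ?thesis
      using abelian_closure_outside_frattini_iso[OF W wreath_product.hyps(3) iso_back] by blast
  qed
next
  case (quotient G N K)
  have pG: "finite_p_group p G" using wreath_family_finite_p_group[OF quotient.hyps(1) p] .
  then have G: "group G" by (simp add: finite_p_group_def)
  interpret N: normal N G by fact
  have Q: "group (G Mod N)" by (rule N.factorgroup_is_group)
  let ?h = "\<lambda>a. N #>\<^bsub>G\<^esub> a"
  have h: "?h \<in> hom G (G Mod N)" "?h ` carrier G = carrier (G Mod N)"
    using N.r_coset_hom_Mod by (auto simp: FactGroup_def RCOSETS_def)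
  note iso_back = group.iso_sym[OF quotient.hyps(4,5)]
  show ?case
  proof (cases "carrier G = {\<one>\<^bsub>G\<^esub>}")
    case True
    then have "carrier (G Mod N) = {\<one>\<^bsub>G Mod N\<^esub>}"
      using hom_one[OF h(1) G Q] unfolding h(2)[symmetric] True by simp
    then show ?thesis using trivial_carrier_iso[OF Q quotient.hyps(4,5)] by blast
  next
    case False
    then have "abelian_closure_outside_frattini p (G Mod N)"
      using quotient.IH
      by (intro abelian_closure_outside_frattini_surj_hom[OF G Q h]
          mod_character_vanishes_on_rank_preserving_kernel[OF p pG Q h quotient.hyps(3)]) auto
    then show ?thesis
      using abelian_closure_outside_frattini_iso[OF Q quotient.hyps(4) iso_back] by blast
  qed
qed

section \<open>Relatively free groups\<close>

text \<open>A finite group that is free on \<open>x 0, \<dots>, x (n - 1)\<close> within the variety it generates: maps from the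
basis into the group itself extend to endomorphisms.\<close>
locale relatively_free_group = group R for R (structure) +
  fixes n :: nat and x :: "nat \<Rightarrow> 'a"
  assumes finite_carrier: "finite (carrier R)"
    and basis_closed: "\<And>i. i < n \<Longrightarrow> x i \<in> carrier R"
    and basis_generates: "generate R (x ` {..<n}) = carrier R"
    and basis_extends: "\<And>s. (\<And>i. i < n \<Longrightarrow> s i \<in> carrier R) \<Longrightarrow> \<exists>e\<in>hom R R. \<forall>i<n. e (x i) = s i"
begin

text \<open>The endomorphism that carries the basis to the generating tuple is surjective, hence injective
as the group is finite.\<close>
lemma generating_tuple_automorphism:
  assumes s: "\<And>i. i < n \<Longrightarrow> s i \<in> carrier R" and gen: "generate R (s ` {..<n}) = carrier R"
  obtains e where "e \<in> hom R R" "\<And>i. i < n \<Longrightarrow> e (x i) = s i" "inj_on e (carrier R)"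
proof -
  obtain e where e: "e \<in> hom R R" "\<And>i. i < n \<Longrightarrow> e (x i) = s i"
    using basis_extends[of s] s by blast
  interpret e: group_hom R R e using e(1) by unfold_locales
  have "generate R (e ` x ` {..<n}) = e ` generate R (x ` {..<n})"
    using e.generate_img[of "x ` {..<n}"] basis_closed by auto
  moreover have "e ` x ` {..<n} = s ` {..<n}" using e(2) by (auto simp: image_image)
  ultimately have "e ` carrier R = carrier R" using gen basis_generates by simp
  then have "inj_on e (carrier R)" using finite_carrier by (simp add: eq_card_imp_inj_on)
  then show ?thesis using that e by blast
qed

text \<open>A generating set with fewer than \<open>n\<close> elements could be padded with \<open>\<one>\<close> to a generating \<open>n\<close>-tuple,
and the corresponding automorphism would send a basis element to \<open>\<one>\<close>.\<close>
lemma group_rank_eq: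
  assumes "\<And>i. i < n \<Longrightarrow> x i \<noteq> \<one>"
  shows "group_rank R = n"
proof (rule antisym)
  have "group_rank R \<le> card (x ` {..<n})"
    using basis_closed basis_generates by (intro group_rank_le) auto
  then show "group_rank R \<le> n" using card_image_le[of "{..<n}" x] by simp
  show "n \<le> group_rank R"
  proof (rule ccontr)
    assume "\<not> n \<le> group_rank R"
    then have less: "group_rank R < n" by simp
    obtain T where T: "T \<subseteq> carrier R" "finite T" "card T = group_rank R" "generate R T = carrier R"
      using group_rank_attained[OF is_group finite_carrier] by blast
    obtain t where "bij_betw t {0..<card T} T" using ex_bij_betw_nat_finite[OF T(2)] by blast
    then have t: "t ` {..<card T} = T" by (simp add: bij_betw_def atLeast0LessThan)
    define s where "s i = (if i < card T then t i else \<one>)" for i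
    have sT: "s i \<in> carrier R" if "i < n" for i
      using t T(1) by (auto simp: s_def)
    have "T \<subseteq> s ` {..<n}"
    proof
      fix y assume "y \<in> T"
      then obtain i where "i < card T" "y = t i" using t by blast
      then show "y \<in> s ` {..<n}" using less T(3) by (intro image_eqI[of _ _ i]) (auto simp: s_def)
    qed
    then have "carrier R \<subseteq> generate R (s ` {..<n})"
      using mono_generate[of T "s ` {..<n}"] T(4) by simp
    moreover have "generate R (s ` {..<n}) \<subseteq> carrier R"
      using sT by (intro generate_incl) auto
    ultimately have "generate R (s ` {..<n}) = carrier R" by blast
    then obtain e where e: "e \<in> hom R R" "\<And>i. i < n \<Longrightarrow> e (x i) = s i" "inj_on e (carrier R)"
      using generating_tuple_automorphism[of s] sT by blast
    have "e (x (group_rank R)) = e \<one>"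
      using e(2)[OF less] hom_one[OF e(1) is_group is_group] T(3) by (simp add: s_def)
    then have "x (group_rank R) = \<one>"
      using e(3) basis_closed[OF less] by (simp add: inj_on_eq_iff)
    then show False using assms[OF less] by simp
  qed
qed

text \<open>An element \<open>a\<close> outside the Frattini subgroup can be exchanged for some basis element \<open>x j\<close>, so an
automorphism maps \<open>x j\<close> to \<open>a\<close> and fixes the other basis elements. As \<open>x j\<close> fails to commute with
its conjugate by \<open>x k\<close>, so does \<open>a\<close>.\<close>
lemma no_abelian_closure_outside_frattini:
  assumes p: "Factorial_Ring.prime p" "finite_p_group p R" and n: "n > 1"
    and noncomm: "\<And>j k. \<lbrakk>j < n; k < n; j \<noteq> k\<rbrakk> \<Longrightarrow>
      \<exists>z\<in>carrier R. z \<otimes> x k = x k \<otimes> x j \<and> z \<otimes> x j \<noteq> x j \<otimes> z"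
  shows "\<not> abelian_closure_outside_frattini p R"
proof
  assume "abelian_closure_outside_frattini p R"
  then obtain a \<chi> where a: "a \<in> carrier R" "commutes_with_conjugates R a"
    and \<chi>: "mod_character p R \<chi>" "\<not> [\<chi> a = 0] (mod int p)"
    unfolding abelian_closure_outside_frattini_def by blast
  have X: "x ` {..<n} \<subseteq> carrier R" using basis_closed by blast
  obtain j where j: "j < n" "generate R (insert a (x ` {..<n} - {x j})) = carrier R"
    using p_group_exchange[OF p X _ basis_generates a(1) \<chi>] by blast
  define s where "s i = (if i = j then a else x i)" for i
  have s: "s i \<in> carrier R" if "i < n" for i using that a(1) basis_closed by (simp add: s_def)
  have "insert a (x ` {..<n} - {x j}) \<subseteq> s ` {..<n}"
  proof
    fix y assume "y \<in> insert a (x ` {..<n} - {x j})"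
    then consider "y = a" | i where "i < n" "i \<noteq> j" "y = x i" by blast
    then show "y \<in> s ` {..<n}"
      by cases (use j(1) in \<open>auto simp: s_def intro: image_eqI[of _ _ j]\<close>)
  qed
  then have "carrier R \<subseteq> generate R (s ` {..<n})"
    using mono_generate j(2) by metis
  moreover have "generate R (s ` {..<n}) \<subseteq> carrier R"
    using s by (intro generate_incl) auto
  ultimately have "generate R (s ` {..<n}) = carrier R" by blast
  then obtain e where e: "e \<in> hom R R" "\<And>i. i < n \<Longrightarrow> e (x i) = s i" "inj_on e (carrier R)"
    using generating_tuple_automorphism[of s] s by blast
  \<comment> \<open>An index other than \<open>j\<close>; it exists because \<open>n > 1\<close>.\<close>
  define k :: nat where "k = (if j = 0 then 1 else 0)"
  have k: "k < n" "k \<noteq> j" using n by (auto simp: k_def)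
  obtain z where z: "z \<in> carrier R" "z \<otimes> x k = x k \<otimes> x j" "z \<otimes> x j \<noteq> x j \<otimes> z"
    using noncomm[OF j(1) k(1)] k(2) by blast
  have ez: "e z \<in> carrier R" using e(1) z(1) by (rule hom_in_carrier)
  have ea: "e (x j) = a" "e (x k) = x k" using e(2) j(1) k by (simp_all add: s_def)
  have "e z \<otimes> x k = x k \<otimes> a"
    using arg_cong[OF z(2), of e] hom_mult[OF e(1)] z(1) basis_closed j(1) k(1) ea by simp
  then have "e z \<otimes> a = a \<otimes> e z"
    using a(2) ez basis_closed[OF k(1)] unfolding commutes_with_conjugates_def by blast
  then have "e (z \<otimes> x j) = e (x j \<otimes> z)"
    using hom_mult[OF e(1)] z(1) basis_closed[OF j(1)] ea by simp
  then have "z \<otimes> x j = x j \<otimes> z"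
    using e(3) z(1) basis_closed[OF j(1)] by (simp add: inj_on_eq_iff)
  then show False using z(3) by blast
qed

end

lemma generate_subgroup_generated:
  assumes "group G" "S \<subseteq> carrier G"
  shows "generate (subgroup_generated G S) S = carrier (subgroup_generated G S)"
proof -
  interpret group G by fact
  let ?R = "subgroup_generated G S"
  have "S \<subseteq> carrier ?R"
    using assms(2) by (auto simp: carrier_subgroup_generated intro: generate.incl)
  then have "generate ?R S = carrier (subgroup_generated ?R S)"
    by (simp add: carrier_subgroup_generated Int_absorb1 del: subgroup_generated2)
  then show ?thesis by simp
qed

text \<open>The elements of \<open>R\<close> are the \<open>n\<close>-ary word functions on \<open>P\<close>, and the basis consists of the variables.
Substituting elements of \<open>R\<close> for the variables gives the endomorphisms, and evaluating at a tuple
with entries \<open>a\<close> and \<open>b\<close> reduces the relations between two basis elements to those between \<open>a\<close> and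
\<open>b\<close> in \<open>P\<close>.\<close>
lemma relatively_free_p_group_exists:
  fixes P :: "('a, 'b) monoid_scheme"
  assumes P: "finite_p_group p P" and a: "a \<in> carrier P" "\<not> commutes_with_conjugates P a"
    and p: "Factorial_Ring.prime p"
  obtains R :: "((nat \<Rightarrow> 'a) \<Rightarrow> 'a) monoid" and x where "finite_p_group p R" "relatively_free_group R n x"
    "\<And>j k. \<lbrakk>j < n; k < n; j \<noteq> k\<rbrakk> \<Longrightarrow>
      \<exists>z\<in>carrier R. z \<otimes>\<^bsub>R\<^esub> x k = x k \<otimes>\<^bsub>R\<^esub> x j \<and> z \<otimes>\<^bsub>R\<^esub> x j \<noteq> x j \<otimes>\<^bsub>R\<^esub> z"
proof -
  have gP: "group P" and finP: "finite (carrier P)" using P by (auto simp: finite_p_group_def)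
  interpret P: group P by fact
  define I where "I = ({..<n} \<rightarrow>\<^sub>E carrier P)"
  define Q where "Q = product_group I (\<lambda>_. P)"
  have gQ: "group Q" unfolding Q_def using gP by simp
  interpret Q: group Q by fact
  have finI: "finite I" unfolding I_def using finP by (intro finite_PiE) auto
  have carrQ: "carrier Q = (I \<rightarrow>\<^sub>E carrier P)" by (simp add: Q_def)
  have multQ: "u \<otimes>\<^bsub>Q\<^esub> v = (\<lambda>\<phi>\<in>I. u \<phi> \<otimes>\<^bsub>P\<^esub> v \<phi>)" for u v by (simp add: Q_def)
  define x where "x i = (\<lambda>\<phi>\<in>I. \<phi> i)" for i :: nat
  have xQ: "x i \<in> carrier Q" if "i < n" for i
    using that by (auto simp: carrQ x_def I_def)
  define B where "B = x ` {..<n}"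
  have BQ: "B \<subseteq> carrier Q" unfolding B_def using xQ by blast
  define R where "R = subgroup_generated Q B"
  have gR: "group R" by (simp add: R_def)
  interpret R: group R by fact
  have multR: "(\<otimes>\<^bsub>R\<^esub>) = (\<otimes>\<^bsub>Q\<^esub>)" by (simp add: R_def)
  have RQ: "carrier R \<subseteq> carrier Q" unfolding R_def by (rule Q.carrier_subgroup_generated_subset)
  have xR: "x i \<in> carrier R" if "i < n" for i
    using that xQ by (auto simp: R_def carrier_subgroup_generated B_def intro!: generate.incl)
  have finQ: "finite (carrier Q)" unfolding carrQ using finI finP by (intro finite_PiE) auto
  then have finR: "finite (carrier R)" using RQ finite_subset by blast
  obtain k where k: "order P = p ^ k" using P by (auto simp: finite_p_group_def)
  have subR: "subgroup (carrier R) Q"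
    unfolding R_def carrier_subgroup_generated by (rule Q.generate_is_subgroup) auto
  then have "order R dvd order Q" using Q.lagrange by (metis dvd_triv_right order_def)
  moreover have "order Q = p ^ (k * card I)"
    using finI k by (simp add: order_def carrQ card_PiE power_mult)
  ultimately have "\<exists>i. order R = p ^ i" using p by (auto simp: divides_primepow_nat)
  then have pR: "finite_p_group p R" using gR finR by (simp add: finite_p_group_def)
  have free: "relatively_free_group R n x"
  proof (unfold_locales)
    show "finite (carrier R)" by fact
    show "x i \<in> carrier R" if "i < n" for i using xR that .
    show "generate R (x ` {..<n}) = carrier R"
      using generate_subgroup_generated[OF gQ BQ] by (simp add: R_def B_def)
    fix s :: "nat \<Rightarrow> (nat \<Rightarrow> 'a) \<Rightarrow> 'a" assume s: "\<And>i. i < n \<Longrightarrow> s i \<in> carrier R"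
    \<comment> \<open>Substitution of the word functions \<open>s i\<close> for the variables.\<close>
    define e where "e r = (\<lambda>\<phi>\<in>I. r (\<lambda>i\<in>{..<n}. s i \<phi>))" for r :: "(nat \<Rightarrow> 'a) \<Rightarrow> 'a"
    have sQ: "s i \<in> I \<rightarrow>\<^sub>E carrier P" if "i < n" for i using s[OF that] RQ carrQ by blast
    have subst: "(\<lambda>i\<in>{..<n}. s i \<phi>) \<in> I" if "\<phi> \<in> I" for \<phi>
    proof -
      have "s i \<phi> \<in> carrier P" if "i < n" for i
        using PiE_mem[OF sQ[OF that] \<open>\<phi> \<in> I\<close>] .
      then show ?thesis unfolding I_def by (simp add: restrict_PiE_iff)
    qed
    have "e \<in> hom Q Q"
    proof (rule homI)
      show "e r \<in> carrier Q" if "r \<in> carrier Q" for r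
        using PiE_mem[OF that[unfolded carrQ] subst] unfolding carrQ e_def
        by (simp add: restrict_PiE_iff)
      show "e (r \<otimes>\<^bsub>Q\<^esub> r') = e r \<otimes>\<^bsub>Q\<^esub> e r'" if "r \<in> carrier Q" "r' \<in> carrier Q" for r r'
        using subst by (simp add: e_def multQ cong: restrict_cong)
    qed
    then interpret e: group_hom Q Q e by unfold_locales
    have ex: "e (x i) = s i" if i: "i < n" for i
    proof
      fix \<phi> show "e (x i) \<phi> = s i \<phi>"
        using sQ[OF i] subst[of \<phi>] i by (cases "\<phi> \<in> I") (auto simp: e_def x_def PiE_def extensional_def)
    qed
    have "e ` B \<subseteq> carrier R" unfolding B_def using ex s by force
    then have "e \<in> hom R (subgroup_generated Q (carrier R))"
      unfolding R_def by (rule e.hom_between_subgroups)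
    also have "hom R (subgroup_generated Q (carrier R)) = hom R R"
      using subgroup.carrier_subgroup_generated_subgroup[OF subR] by (simp add: hom_def multR)
    finally show "\<exists>e\<in>hom R R. \<forall>i<n. e (x i) = s i" using ex by blast
  qed
  have noncomm: "\<exists>z\<in>carrier R. z \<otimes>\<^bsub>R\<^esub> x k = x k \<otimes>\<^bsub>R\<^esub> x j \<and> z \<otimes>\<^bsub>R\<^esub> x j \<noteq> x j \<otimes>\<^bsub>R\<^esub> z"
    if jk: "j < n" "k < n" "j \<noteq> k" for j k
  proof (rule bexI, rule conjI)
    let ?z = "x k \<otimes>\<^bsub>R\<^esub> x j \<otimes>\<^bsub>R\<^esub> inv\<^bsub>R\<^esub> (x k)"
    show zR: "?z \<in> carrier R" using xR jk by simp
    show zk: "?z \<otimes>\<^bsub>R\<^esub> x k = x k \<otimes>\<^bsub>R\<^esub> x j" using xR jk by (simp add: R.m_assoc)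
    show "?z \<otimes>\<^bsub>R\<^esub> x j \<noteq> x j \<otimes>\<^bsub>R\<^esub> ?z"
    proof
      assume zj: "?z \<otimes>\<^bsub>R\<^esub> x j = x j \<otimes>\<^bsub>R\<^esub> ?z"
      obtain b y where b: "b \<in> carrier P" "y \<in> carrier P" "y \<otimes>\<^bsub>P\<^esub> b = b \<otimes>\<^bsub>P\<^esub> a"
        and ya: "y \<otimes>\<^bsub>P\<^esub> a \<noteq> a \<otimes>\<^bsub>P\<^esub> y"
        using a(2) unfolding commutes_with_conjugates_def by blast
      define \<phi> where "\<phi> = (\<lambda>i\<in>{..<n}. if i = j then a else b)"
      have \<phi>I: "\<phi> \<in> I" using a(1) b(1) by (auto simp: \<phi>_def I_def)
      have ev: "x j \<phi> = a" "x k \<phi> = b" using \<phi>I jk by (simp_all add: x_def \<phi>_def)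
      have z\<phi>: "?z \<phi> \<in> carrier P" using zR RQ carrQ \<phi>I by blast
      have "?z \<phi> \<otimes>\<^bsub>P\<^esub> b = b \<otimes>\<^bsub>P\<^esub> a"
        using fun_cong[OF zk, of \<phi>] \<phi>I ev by (simp add: multR multQ)
      then have "?z \<phi> \<otimes>\<^bsub>P\<^esub> b = y \<otimes>\<^bsub>P\<^esub> b" using b(3) by simp
      then have "?z \<phi> = y" using P.right_cancel[OF b(1) z\<phi> b(2)] by blast
      moreover have "?z \<phi> \<otimes>\<^bsub>P\<^esub> a = a \<otimes>\<^bsub>P\<^esub> ?z \<phi>"
        using fun_cong[OF zj, of \<phi>] \<phi>I ev by (simp add: multR multQ)
      ultimately show False using ya by simp
    qed
  qed
  show ?thesis using that[OF pR free noncomm] .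
qed

section \<open>A p-group with noncommuting conjugates\<close>

text \<open>Conjugating the top element \<open>g\<close> by the base element \<open>u\<close> with single entry \<open>h\<close> at \<open>\<one>\<close> gives
\<open>(v, g)\<close>, where \<open>v\<close> has the entries \<open>h\<close> at \<open>\<one>\<close> and \<open>h\<inverse>\<close> at \<open>g\<close>. It commutes with \<open>g\<close> only if \<open>v\<close> is
invariant under translation by \<open>g\<close>; this fails at the coordinate \<open>g\<^sup>2\<close>, where \<open>v\<close> is trivial
while its translate has the entry \<open>h\<inverse>\<close>.\<close>
lemma regular_wreath_top_not_commutes_with_conjugates:
  assumes H: "group H" and G: "group G" and h: "h \<in> carrier H" "h \<noteq> \<one>\<^bsub>H\<^esub>"
    and g: "g \<in> carrier G" "g \<noteq> \<one>\<^bsub>G\<^esub>" "g \<otimes>\<^bsub>G\<^esub> g \<noteq> \<one>\<^bsub>G\<^esub>"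
  shows "\<not> commutes_with_conjugates (regular_wreath H G) (\<lambda>x\<in>carrier G. \<one>\<^bsub>H\<^esub>, g)"
proof
  interpret H: group H by fact
  interpret G: group G by fact
  let ?W = "regular_wreath H G"
  let ?a = "(\<lambda>x\<in>carrier G. \<one>\<^bsub>H\<^esub>, g)"
  define u where "u = (\<lambda>x\<in>carrier G. if x = \<one>\<^bsub>G\<^esub> then h else \<one>\<^bsub>H\<^esub>)"
  define v where "v = (\<lambda>x\<in>carrier G. if x = \<one>\<^bsub>G\<^esub> then h else if x = g then inv\<^bsub>H\<^esub> h else \<one>\<^bsub>H\<^esub>)"
  assume comm: "commutes_with_conjugates ?W ?a"
  have carr: "(u, \<one>\<^bsub>G\<^esub>) \<in> carrier ?W" "(v, g) \<in> carrier ?W"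
    using h g by (auto simp: carrier_regular_wreath u_def v_def)
  have shift: "inv\<^bsub>G\<^esub> g \<otimes>\<^bsub>G\<^esub> x = \<one>\<^bsub>G\<^esub> \<longleftrightarrow> x = g" if "x \<in> carrier G" for x
    using g(1) that by (metis G.inv_closed G.inv_equality G.inv_inv G.l_inv)
  have gg: "g \<otimes>\<^bsub>G\<^esub> g \<noteq> g" using g(1,2) by simp
  have "(v, g) \<otimes>\<^bsub>?W\<^esub> (u, \<one>\<^bsub>G\<^esub>) = (u, \<one>\<^bsub>G\<^esub>) \<otimes>\<^bsub>?W\<^esub> ?a"
  proof -
    have "v x \<otimes>\<^bsub>H\<^esub> u (inv\<^bsub>G\<^esub> g \<otimes>\<^bsub>G\<^esub> x) = u x" if "x \<in> carrier G" for x
      using that g h shift[OF that] by (auto simp: u_def v_def)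
    moreover have "u x \<otimes>\<^bsub>H\<^esub> (\<lambda>x\<in>carrier G. \<one>\<^bsub>H\<^esub>) (inv\<^bsub>G\<^esub> \<one>\<^bsub>G\<^esub> \<otimes>\<^bsub>G\<^esub> x) = u x" if "x \<in> carrier G" for x
      using that h by (simp add: u_def)
    ultimately show ?thesis
      using g by (simp add: mult_regular_wreath[OF G] cong: restrict_cong)
  qed
  then have "(v, g) \<otimes>\<^bsub>?W\<^esub> ?a = ?a \<otimes>\<^bsub>?W\<^esub> (v, g)"
    using comm carr unfolding commutes_with_conjugates_def by blast
  then have "(\<lambda>x\<in>carrier G. v x \<otimes>\<^bsub>H\<^esub> (\<lambda>x\<in>carrier G. \<one>\<^bsub>H\<^esub>) (inv\<^bsub>G\<^esub> g \<otimes>\<^bsub>G\<^esub> x)) (g \<otimes>\<^bsub>G\<^esub> g) =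
      (\<lambda>x\<in>carrier G. (\<lambda>x\<in>carrier G. \<one>\<^bsub>H\<^esub>) x \<otimes>\<^bsub>H\<^esub> v (inv\<^bsub>G\<^esub> g \<otimes>\<^bsub>G\<^esub> x)) (g \<otimes>\<^bsub>G\<^esub> g)"
    using mult_regular_wreath[OF G g(1), where H = H] by simp
  moreover have "inv\<^bsub>G\<^esub> g \<otimes>\<^bsub>G\<^esub> (g \<otimes>\<^bsub>G\<^esub> g) = g" using g(1) by (simp add: G.m_assoc[symmetric])
  ultimately have "\<one>\<^bsub>H\<^esub> = inv\<^bsub>H\<^esub> h"
    using g h gg by (simp add: v_def)
  then show False using h by (metis H.inv_inv H.inv_one)
qed

text \<open>The top group has order \<open>p\<^sup>2\<close> rather than \<open>p\<close> so that its generator has order greater than 2 also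
for \<open>p = 2\<close>.\<close>
lemma p_group_with_noncommuting_conjugates:
  assumes p: "Factorial_Ring.prime p"
  defines "P \<equiv> regular_wreath (integer_mod_group p) (integer_mod_group (p ^ 2))"
  shows "finite_p_group p P" and "\<exists>a\<in>carrier P. \<not> commutes_with_conjugates P a"
proof -
  let ?H = "integer_mod_group p" and ?G = "integer_mod_group (p ^ 2)"
  have p2: "p \<ge> 2" using p by (rule prime_ge_2_nat)
  then have "p * p \<ge> 2 * 2" by (intro mult_le_mono) auto
  then have p4: "p ^ 2 \<ge> 4" by (simp add: power2_eq_square)
  have ord: "order (integer_mod_group m) = m" "finite (carrier (integer_mod_group m))" if "m > 0" for m
    using that by (simp_all add: order_def carrier_integer_mod_group)
  have "finite (carrier P)"
    using ord[of p] ord[of "p ^ 2"] p2 p4 by (auto simp: P_def carrier_regular_wreath intro!: finite_PiE)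
  moreover have "order P = p ^ (p ^ 2 + 2)"
    using ord[of p] ord[of "p ^ 2"] p2 p4 order_regular_wreath[of ?G ?H] by (simp add: P_def power_add power2_eq_square)
  moreover have "group P" unfolding P_def by (intro regular_wreath_group) simp_all
  ultimately show "finite_p_group p P" unfolding finite_p_group_def by blast
  let ?a = "(\<lambda>x\<in>carrier ?G. \<one>\<^bsub>?H\<^esub>, 1)"
  have "\<not> commutes_with_conjugates P ?a"
    unfolding P_def
  proof (rule regular_wreath_top_not_commutes_with_conjugates)
    show "1 \<in> carrier ?H" "1 \<in> carrier ?G"
      using p2 p4 by (auto simp: carrier_integer_mod_group)
    have "int (p ^ 2) \<ge> 4" using p4 by linarith
    then show "1 \<otimes>\<^bsub>?G\<^esub> 1 \<noteq> \<one>\<^bsub>?G\<^esub>" by simp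
  qed simp_all
  moreover have "?a \<in> carrier P"
    using p4 one_less_power[of "int p" 2] p2
    by (auto simp: P_def carrier_regular_wreath carrier_integer_mod_group)
  ultimately show "\<exists>a\<in>carrier P. \<not> commutes_with_conjugates P a" by blast
qed

section \<open>Groups outside the family in every rank\<close>

theorem proposition2:
  fixes l n :: nat
  assumes "Factorial_Ring.prime l" and "n > 1"
  shows "\<exists>G :: nat monoid. finite_p_group l G \<and> group_rank G = n \<and> \<not> wreath_family l G"
proof -
  obtain a where a: "a \<in> carrier (regular_wreath (integer_mod_group l) (integer_mod_group (l ^ 2)))"
    "\<not> commutes_with_conjugates (regular_wreath (integer_mod_group l) (integer_mod_group (l ^ 2))) a"
    using p_group_with_noncommuting_conjugates(2)[OF assms(1)] by blast
  obtain R :: "((nat \<Rightarrow> (int \<Rightarrow> int) \<times> int) \<Rightarrow> (int \<Rightarrow> int) \<times> int) monoid" and x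
    where R: "finite_p_group l R" and free: "relatively_free_group R n x"
      and noncomm: "\<And>j k. \<lbrakk>j < n; k < n; j \<noteq> k\<rbrakk> \<Longrightarrow>
        \<exists>z\<in>carrier R. z \<otimes>\<^bsub>R\<^esub> x k = x k \<otimes>\<^bsub>R\<^esub> x j \<and> z \<otimes>\<^bsub>R\<^esub> x j \<noteq> x j \<otimes>\<^bsub>R\<^esub> z"
    using relatively_free_p_group_exists[OF p_group_with_noncommuting_conjugates(1)[OF assms(1)]
        a assms(1), of n] by blast
  interpret R: relatively_free_group R n x by fact
  have nontrivial: "x j \<noteq> \<one>\<^bsub>R\<^esub>" if j: "j < n" for j
  proof
    assume one: "x j = \<one>\<^bsub>R\<^esub>"
    have "(if j = 0 then 1 else 0) < n" "j \<noteq> (if j = 0 then 1 else 0)" using assms(2) by auto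
    then obtain z where "z \<in> carrier R" "z \<otimes>\<^bsub>R\<^esub> x j \<noteq> x j \<otimes>\<^bsub>R\<^esub> z"
      using noncomm[OF j] by blast
    then show False by (simp add: one)
  qed
  have "finite (carrier R)" by (rule R.finite_carrier)
  then obtain K :: "nat monoid" where K: "group K" "K \<cong> R"
    using finite_group_nat_copy[OF R.is_group] by blast
  have RK: "R \<cong> K" using group.iso_sym[OF K] .
  have "finite_p_group l K"
    using R K(1) iso_same_card[OF RK] iso_finite[OF RK]
    by (simp add: finite_p_group_def order_def)
  moreover have "group_rank K = n"
    using group_rank_iso[OF R.is_group R.finite_carrier K(1) RK] R.group_rank_eq nontrivial by simp
  moreover have "\<not> wreath_family l K"
  proof
    assume "wreath_family l K"
    then consider "carrier K = {\<one>\<^bsub>K\<^esub>}" | "abelian_closure_outside_frattini l K"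
      using wreath_family_abelian_closure_outside_frattini[OF _ assms(1)] by blast
    then show False
    proof cases
      case 1
      then have "carrier R = {\<one>\<^bsub>R\<^esub>}" by (rule trivial_carrier_iso[OF K(1) R.is_group RK])
      then show False using R.basis_closed[of 0] nontrivial[of 0] assms(2) by simp
    next
      case 2
      then have "abelian_closure_outside_frattini l R"
        by (rule abelian_closure_outside_frattini_iso[OF K(1) R.is_group K(2)])
      then show False
        using R.no_abelian_closure_outside_frattini[OF assms(1) R assms(2) noncomm] by blast
    qed
  qed
  ultimately show ?thesis by blast
qed

end
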